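(* Let $t>0$, $\alpha_*=1/\sqrt2$, $q_N=\alpha_*N/t$ for $N\ge1$, and let $(m_N)$ be a sequence of positive integers. (i) If $m_N=N+o(N)$, then $$\lim_{N\to\infty}\left(\mathcal E_{m_N}^{\rm rat}(t,q_N)\right)^{1/m_N}=\sqrt2-1 .$$ (ii) If $m_N/N\to1+\epsilon$ with $|\epsilon|$ sufficiently small, then the realized root factor $\lim_{N\to\infty}\left(\mathcal E_{m_N}^{\rm rat}(t,q_N)\right)^{1/m_N}=H_e\!\left(\frac{\alpha_*}{1+\epsilon}\right)$ satisfies, as $\epsilon\to0$, $$\log H_e\!\left(\frac{\alpha_*}{1+\epsilon}\right)=\log(\sqrt2-1)+\frac{\epsilon^2}{5\sqrt2}+O(\epsilon^3).$$
   Context: For $q>0$ and an integer $m\ge0$, $\mathcal R_m(q)=\left\{\frac{P_m(z)}{(q-z)^m}:\ P_m\text{ a polynomial},\ \deg P_m\le m\right\}$, and for $t>0$, $$\mathcal E_m^{\rm rat}(t,q)=\inf_{r\in\mathcal R_m(q)}\ \sup_{z\le0}|e^{tz}-r(z)| .$$ For $0<\alpha<\alpha_c=\frac{3\sqrt3}2$, $\zeta_\alpha$ is the unique root of $\alpha(\zeta^3-\zeta)+1=0$ in the open first quadrant, and $H_e(\alpha)=\left|\frac{\zeta_\alpha-1}{\zeta_\alpha+1}\right|\exp\bigl(\alpha\operatorname{Re}(\zeta_\alpha^2)\bigr)$. *)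

theory Defs
  imports
    "HOL-Complex_Analysis.Complex_Analysis"
    "HOL-Library.Landau_Symbols"
    "HOL-Computational_Algebra.Polynomial"
begin

definition rat_class :: "nat \<Rightarrow> real \<Rightarrow> (complex \<Rightarrow> complex) set" where
  "rat_class m q = {(\<lambda>z. poly P z / (of_real q - z) ^ m) | P :: complex poly. degree P \<le> m}"

(* For q > 0 every element of rat_class m q is bounded on the half-line z \<le> 0, because the degree
   of the numerator is at most m; hence the real-valued SUP below is a genuine supremum for t > 0,
   and the INF is taken over a nonempty set of nonnegative numbers. *)
definition rat_error :: "nat \<Rightarrow> real \<Rightarrow> real \<Rightarrow> real" where
  "rat_error m t q =
     (INF r \<in> rat_class m q. SUP z \<in> {..0 :: real}. cmod (exp (of_real (t * z)) - r (of_real z)))"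

definition alpha_c :: real where
  "alpha_c = 3 * sqrt 3 / 2"

definition alpha_star :: real where
  "alpha_star = 1 / sqrt 2"

(* Meaningful for 0 < \<alpha> < alpha_c, where the cubic has exactly one root in the open first quadrant. *)
definition zeta_root :: "real \<Rightarrow> complex" where
  "zeta_root \<alpha> = (THE \<zeta>. 0 < Re \<zeta> \<and> 0 < Im \<zeta> \<and> of_real \<alpha> * (\<zeta> ^ 3 - \<zeta>) + 1 = 0)"

definition H_e :: "real \<Rightarrow> real" where
  "H_e \<alpha> = cmod ((zeta_root \<alpha> - 1) / (zeta_root \<alpha> + 1)) * exp (\<alpha> * Re ((zeta_root \<alpha>)\<^sup>2))"

end

theory Submission
  imports Defs "HOL-Probability.Probability" "HOL-Real_Asymp.Real_Asymp"
begin

text \<open>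
  Substitute \<open>z = -q y\<^sup>2\<close> and write \<open>u = q / (q - z) = 1 / (1 + y\<^sup>2)\<close>, \<open>a = t q\<close>. The functions in
  \<open>rat_class m q\<close> become the polynomials of degree at most \<open>m\<close> in \<open>u\<close>, and \<open>e\<^sup>t\<^sup>z\<close> becomes
  \<open>exp (a \<zeta>\<^sup>2)\<close> at the point \<open>\<zeta> = i y\<close> of the imaginary axis. The Cayley variable
  \<open>w = (1 - \<zeta>) / (1 + \<zeta>)\<close> maps that axis to the unit circle and \<open>2 u - 1\<close> is \<open>(w + 1 / w) / 2\<close>
  there, so the problem is polynomial approximation on an interval in its Chebyshev form, for a
  function with an essential singularity at the end point \<open>u = 0\<close>.

  Both bounds for the error are integrals over a vertical line \<open>Re \<zeta> = p > 0\<close> whose integrand has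
  the size of \<open>exp (a \<zeta>\<^sup>2) w\<^sup>m\<close>, that is, of the \<open>m\<close>-th power of \<open>exp (\<alpha> \<zeta>\<^sup>2) w\<close> with \<open>\<alpha> = a / m\<close>.
  The critical points of this function are the roots of \<open>\<alpha> (\<zeta>\<^sup>3 - \<zeta>) + 1\<close>, and its modulus at
  \<open>\<zeta>\<^sub>\<alpha>\<close> is \<open>H\<^sub>e(\<alpha>)\<close>. On the vertical line through \<open>\<zeta>\<^sub>\<alpha>\<close> the modulus is largest exactly at \<open>\<zeta>\<^sub>\<alpha>\<close> and its
  conjugate, with Gaussian decay away from them (\<open>line_modulus_le\<close>), so this line serves as the
  contour for both bounds.

  Upper bound (\<open>rat_error_upper\<close>): Cauchy's formula writes \<open>exp (- a y\<^sup>2)\<close> as the integral of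
  \<open>exp (a \<zeta>\<^sup>2) \<cdot> 2 \<zeta> / (\<zeta>\<^sup>2 + y\<^sup>2)\<close> over the line. Expanding the kernel in Chebyshev polynomials of the
  second kind and cutting the expansion gives an approximant of degree \<open>m\<close> whose remainder carries
  the factor \<open>w\<^sup>m\<close>, so the error is at most a constant times \<open>m H\<^sub>e(\<alpha>)\<^sup>m\<close>.

  Lower bound (\<open>rat_error_lower\<close>): integration against \<open>w\<^sup>k d\<zeta> / (1 - \<zeta>\<^sup>2)\<close> along the imaginary axis is a
  Fourier coefficient, a functional of norm at most \<open>\<pi>\<close>. For \<open>k > m\<close> it annihilates the rational
  class, and its value at the exponential is again an integral over the line through the saddle.
  Laplace's method shows that this value is twice the real part of a complex number of modulus
  about \<open>H\<^sub>e(\<alpha>)\<^sup>m / \<surd>m\<close>. The real part may vanish for one \<open>k\<close>, but passing from \<open>k = m + 1\<close> to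
  \<open>k = m + 2\<close> multiplies the number by approximately \<open>w(\<zeta>\<^sub>\<alpha>)\<close>, which is not real, so one of the two
  real parts is large (\<open>abs_Im_cnj_mult_le\<close>).

  Taking \<open>m\<close>-th roots leaves the limit of \<open>H\<^sub>e(a / m)\<close>. The equation for \<open>\<zeta>\<^sub>\<alpha>\<close> is solved by using
  \<open>p = Re \<zeta>\<^sub>\<alpha>\<close> as the parameter: the three roots have sum \<open>0\<close>, so the real one is \<open>-2 p\<close>, and \<open>\<alpha>\<close>, the
  imaginary part and \<open>H\<^sub>e(\<alpha>)\<close> are elementary functions of \<open>p\<close>. The balanced case \<open>\<alpha> = 1 / \<surd>2\<close> is
  \<open>p = 1 / \<surd>2\<close>, and the second-order expansion is a computation in \<open>p\<close>.
\<close>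

section \<open>The saddle point, parametrised by its real part\<close>

definition saddle :: "real \<Rightarrow> complex" where
  "saddle p = Complex p (sqrt (3 * p\<^sup>2 - 1))"

definition saddle_alpha :: "real \<Rightarrow> real" where
  "saddle_alpha p = 1 / (2 * p * (4 * p\<^sup>2 - 1))"

text \<open>
  This is \<open>H\<^sub>e(\<alpha>)\<close> as a function of the real part \<open>p\<close> of \<open>\<zeta>\<^sub>\<alpha>\<close>; see \<open>H_e_saddle_alpha\<close>.
\<close>
definition rate :: "real \<Rightarrow> real" where
  "rate p = sqrt ((2 * p - 1) / (2 * p + 1)) * exp ((1 - 2 * p\<^sup>2) / (2 * p * (4 * p\<^sup>2 - 1)))"

text \<open>
  The function whose \<open>m\<close>-th power is \<open>exp (a \<zeta>\<^sup>2) w\<^sup>m\<close> when \<open>a = m \<alpha>\<close>; \<open>saddle p\<close> is one of its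
  critical points.
\<close>
definition line_phase :: "real \<Rightarrow> complex \<Rightarrow> complex" where
  "line_phase p z = exp (of_real (saddle_alpha p) * z\<^sup>2) * ((1 - z) / (1 + z))"

text \<open>
  The limit of \<open>m\<^sub>N / N\<close> for which the saddle has real part \<open>p\<close>: it equals \<open>\<alpha>\<^sub>* / \<alpha>\<close>, the quantity
  \<open>1 + \<epsilon>\<close> of the theorem.
\<close>
definition degree_ratio :: "real \<Rightarrow> real" where
  "degree_ratio p = sqrt 2 * p * (4 * p\<^sup>2 - 1)"

text \<open>
  The parametrisation makes sense for \<open>p > 1 / \<surd>3\<close>. The interval from \<open>3/5\<close> to \<open>4/5\<close> keeps a distance
  from that bound, contains the balanced value \<open>1 / \<surd>2\<close>, and is mapped by \<open>degree_ratio\<close> onto a set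
  containing the interval from \<open>1/2\<close> to \<open>3/2\<close>.
\<close>
lemma three_p_sq_gt_1: "3 * p\<^sup>2 > 1" if "p \<ge> (3/5::real)"
proof -
  have "(3/5)\<^sup>2 \<le> p\<^sup>2" using that by (intro power_mono) auto
  thus ?thesis by (simp add: power2_eq_square)
qed

lemma saddle_alpha_pos: "saddle_alpha p > 0" if "p \<ge> 3/5"
  using that three_p_sq_gt_1[OF that] by (auto simp: saddle_alpha_def intro!: mult_pos_pos)

lemma alpha_star_degree_ratio: "alpha_star / degree_ratio p = saddle_alpha p"
  by (simp add: alpha_star_def degree_ratio_def saddle_alpha_def field_simps)

lemma saddle_Re: "Re (saddle p) = p"
  and saddle_Im: "Im (saddle p) = sqrt (3 * p\<^sup>2 - 1)"
  by (auto simp: saddle_def)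

lemma saddle_Im_sq: "(Im (saddle p))\<^sup>2 = 3 * p\<^sup>2 - 1" if "p \<ge> 3/5"
  using three_p_sq_gt_1[OF that] by (simp add: saddle_Im)

lemma saddle_Im_pos: "Im (saddle p) > 0" if "p \<ge> 3/5"
  using three_p_sq_gt_1[OF that] by (simp add: saddle_Im)

text \<open>
  Vieta: \<open>p \<plusminus> i r\<close> and \<open>-2 p\<close> have sum \<open>0\<close>; their pairwise products sum to \<open>r\<^sup>2 - 3 p\<^sup>2 = -1\<close>, which is
  why \<open>r\<^sup>2 = 3 p\<^sup>2 - 1\<close>; and their product fixes \<open>\<alpha>\<close>. Uniqueness of the root in the first quadrant is
  read off from the factors.
\<close>
lemma cubic_factorization:
  assumes "p \<ge> 3/5"
  shows "of_real (saddle_alpha p) * (z ^ 3 - z) + 1 =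
    of_real (saddle_alpha p) * (z - saddle p) * (z - cnj (saddle p)) * (z + of_real (2 * p))"
proof -
  define s where "s = saddle p"
  have sum: "s + cnj s = of_real (2 * p)"
    by (simp add: s_def saddle_Re complex_add_cnj)
  have prod: "s * cnj s = of_real (4 * p\<^sup>2 - 1)"
    using saddle_Im_sq[OF assms] by (simp add: s_def saddle_Re complex_mult_cnj)
  have al: "of_real (saddle_alpha p) * (of_real (2 * p) * of_real (4 * p\<^sup>2 - 1)) = (1 :: complex)"
    using assms three_p_sq_gt_1[OF assms]
    by (simp only: of_real_mult[symmetric]) (auto simp: saddle_alpha_def field_simps)
  have "(z - s) * (z - cnj s) * (z + of_real (2 * p)) =
        (z\<^sup>2 - (s + cnj s) * z + s * cnj s) * (z + of_real (2 * p))"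
    by (simp add: algebra_simps power2_eq_square)
  also have "\<dots> = z ^ 3 - z + of_real (2 * p) * of_real (4 * p\<^sup>2 - 1)"
    unfolding sum prod by (simp add: algebra_simps power2_eq_square power3_eq_cube)
  finally have "of_real (saddle_alpha p) * ((z - s) * (z - cnj s) * (z + of_real (2 * p))) =
      of_real (saddle_alpha p) * (z ^ 3 - z) + 1"
    using al by (simp add: distrib_left)
  thus ?thesis by (simp add: s_def mult.assoc)
qed

lemma zeta_root_saddle_alpha:
  assumes "p \<ge> 3/5"
  shows "zeta_root (saddle_alpha p) = saddle p"
  unfolding zeta_root_def
proof (rule the_equality)
  show "0 < Re (saddle p) \<and> 0 < Im (saddle p) \<and>
      of_real (saddle_alpha p) * (saddle p ^ 3 - saddle p) + 1 = 0"
    unfolding cubic_factorization[OF assms] using assms saddle_Im_pos[OF assms] by (simp add: saddle_Re)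
next
  fix z assume z: "0 < Re z \<and> 0 < Im z \<and> of_real (saddle_alpha p) * (z ^ 3 - z) + 1 = 0"
  have "z + of_real (2 * p) \<noteq> 0" 
    using z assms by (auto simp: complex_eq_iff)
  moreover have "z - cnj (saddle p) \<noteq> 0"
    using z saddle_Im_pos[OF assms] by (auto simp: complex_eq_iff)
  ultimately show "z = saddle p"
    using z saddle_alpha_pos[OF assms] unfolding cubic_factorization[OF assms] by auto
qed

lemma H_e_saddle_alpha:
  assumes "p \<ge> 3/5"
  shows "H_e (saddle_alpha p) = rate p"
proof -
  note r = saddle_Im_sq[OF assms] three_p_sq_gt_1[OF assms]
  have n1: "(cmod (saddle p - 1))\<^sup>2 = 2 * p * (2 * p - 1)"
    unfolding cmod_power2 using r by (simp add: saddle_Re power2_eq_square algebra_simps)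
  have n2: "(cmod (saddle p + 1))\<^sup>2 = 2 * p * (2 * p + 1)"
    unfolding cmod_power2 using r by (simp add: saddle_Re power2_eq_square algebra_simps)
  have "cmod ((saddle p - 1) / (saddle p + 1)) = sqrt ((cmod (saddle p - 1))\<^sup>2 / (cmod (saddle p + 1))\<^sup>2)"
    by (simp add: norm_divide real_sqrt_divide)
  also have "\<dots> = sqrt ((2 * p - 1) / (2 * p + 1))"
    unfolding n1 n2 using assms by simp
  finally have 1: "cmod ((saddle p - 1) / (saddle p + 1)) = sqrt ((2 * p - 1) / (2 * p + 1))" .
  have "Re ((saddle p)\<^sup>2) = 1 - 2 * p\<^sup>2"
    using r by (simp add: saddle_Re power2_eq_square)
  thus ?thesis
    unfolding H_e_def zeta_root_saddle_alpha[OF assms] 1 by (simp add: rate_def saddle_alpha_def)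
qed

text \<open>
  This makes the inverse of \<open>degree_ratio\<close> Lipschitz with constant \<open>1\<close>: it gives the convergence
  of the saddles when \<open>m\<^sub>N / N\<close> converges, and transfers the \<open>O\<close>-bound from \<open>p - 1 / \<surd>2\<close> to \<open>\<epsilon>\<close>.
\<close>
lemma degree_ratio_expanding:
  assumes "x \<ge> 3/5" "y \<ge> 3/5"
  shows "\<bar>x - y\<bar> \<le> \<bar>degree_ratio x - degree_ratio y\<bar>"
proof -
  have "a * b \<ge> (3/5) * (3/5)" if "a \<ge> 3/5" "b \<ge> 3/5" for a b :: real
    using that by (intro mult_mono) auto
  from this[of x x] this[of x y] this[of y y] assms have A: "4 * (x\<^sup>2 + x * y + y\<^sup>2) - 1 \<ge> 1" by (simp add: power2_eq_square)
  have "degree_ratio x - degree_ratio y = (x - y) * (sqrt 2 * (4 * (x\<^sup>2 + x * y + y\<^sup>2) - 1))"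
    by (simp add: degree_ratio_def algebra_simps power2_eq_square)
  also have "\<bar>\<dots>\<bar> = \<bar>x - y\<bar> * (sqrt 2 * (4 * (x\<^sup>2 + x * y + y\<^sup>2) - 1))"
    using A by (simp add: abs_mult)
  also have "\<dots> \<ge> \<bar>x - y\<bar> * (1 * 1)"
    using A by (intro mult_left_mono mult_mono) auto
  finally show ?thesis by simp
qed

lemma degree_ratio_surj:
  assumes "1/2 \<le> x" "x \<le> 3/2"
  obtains p where "p \<ge> 3/5" "p \<le> 4/5" "degree_ratio p = x"
proof -
  have s: "sqrt 2 < 3/2" "sqrt 2 > 7/5"
    by (rule real_less_lsqrt real_less_rsqrt; simp add: power2_eq_square)+
  have "\<exists>p. 3/5 \<le> p \<and> p \<le> 4/5 \<and> degree_ratio p = x"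
    by (rule IVT') (use s assms in \<open>auto simp: degree_ratio_def power2_eq_square intro!: continuous_intros\<close>)
  thus ?thesis using that by auto
qed

lemma degree_ratio_center: "degree_ratio (1 / sqrt 2) = 1"
  by (simp add: degree_ratio_def power_divide)

lemma inv_sqrt2_bounds: "3/5 \<le> 1 / sqrt 2" "1 / sqrt 2 \<le> (4/5 :: real)"
proof -
  have "sqrt 2 \<le> 5/3" "sqrt 2 \<ge> 5/4"
    by (rule real_le_lsqrt real_le_rsqrt; simp add: power2_eq_square)+
  thus "3/5 \<le> 1 / sqrt 2" "1 / sqrt 2 \<le> (4/5 :: real)" by (auto simp: field_simps)
qed

lemma rate_center: "rate (1 / sqrt 2) = sqrt 2 - 1"
proof -
  have "(2 * (1 / sqrt 2) - 1) / (2 * (1 / sqrt 2) + 1) = (sqrt 2 - 1) / (sqrt 2 + 1)"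
    by (simp add: real_div_sqrt)
  also have "\<dots> = (sqrt 2 - 1)\<^sup>2"
    using add_pos_pos[of "sqrt 2" 1] by (simp add: divide_eq_eq) (simp add: power2_eq_square algebra_simps)
  finally have "(2 * (1 / sqrt 2) - 1) / (2 * (1 / sqrt 2) + 1) = (sqrt 2 - 1)\<^sup>2" .
  thus ?thesis by (simp add: rate_def power_divide)
qed

lemma rate_pos: "p \<ge> 3/5 \<Longrightarrow> rate p > 0"
  by (simp add: rate_def)

section \<open>Second-order expansion of the rate\<close>

text \<open>
  With \<open>x = \<surd>2 p\<close> the balanced point is \<open>x = 1\<close> and \<open>\<epsilon> = 2 x\<^sup>3 - x - 1\<close>, so the difference is an
  explicit function \<open>D\<close> of \<open>x\<close>. Since \<open>d log H\<^sub>e / d\<alpha> = Re (\<zeta>\<^sub>\<alpha>\<^sup>2) = 1 - 2 p\<^sup>2\<close> vanishes at the balanced point,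
  the linear term is absent; the coefficient of \<open>\<epsilon>\<^sup>2\<close> is the one that makes the derivative \<open>D'\<close>
  divisible by \<open>(x - 1)\<^sup>2\<close>. Integrating \<open>D'\<close> from \<open>1\<close> to \<open>x\<close> yields the cubic bound.
\<close>
lemma ln_rate_expansion:
  "\<exists>C. \<forall>x\<in>{4/5..6/5}. \<bar>ln (rate (x / sqrt 2)) - (ln (sqrt 2 - 1) + (degree_ratio (x / sqrt 2) - 1)\<^sup>2 / (5 * sqrt 2))\<bar>
      \<le> C * \<bar>x - 1\<bar> ^ 3"
proof -
  define s where "s = sqrt 2"
  have s: "s * s = 2" "s > 7/5"
    unfolding s_def by (simp, rule real_less_rsqrt, simp add: power2_eq_square)
  define D where "D = (\<lambda>x. (ln (s * x - 1) - ln (s * x + 1)) / 2 + (1 - x\<^sup>2) / (s * x * (2 * x\<^sup>2 - 1))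
       - (2 * x ^ 3 - x - 1)\<^sup>2 / (5 * s))"
  \<comment> \<open>The cofactor of \<open>(x - 1)\<^sup>2\<close> in \<open>D\'\<close>, found by polynomial division.\<close>
  define K where "K = (\<lambda>x::real. - (6 * x\<^sup>2 - 1) * 
      (16 * x ^ 7 + 32 * x ^ 6 + 24 * x ^ 5 + 8 * x ^ 4 + 4 * x ^ 3 + 8 * x ^ 2 + 10 * x + 5) / 
      (5 * s * x\<^sup>2 * (2 * x\<^sup>2 - 1)\<^sup>2))"
  have pos: "2 * x\<^sup>2 - 1 > 0" "s * x - 1 > 0" if "x \<ge> 4/5" for x
  proof -
    have "x * x \<ge> (4/5) * (4/5)" "s * x \<ge> 7/5 * (4/5)" 
      using that s(2) mult_mono[of "4/5" x "4/5" x] mult_mono[of "7/5" s "4/5" x] by auto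
    thus "2 * x\<^sup>2 - 1 > 0" "s * x - 1 > 0" by (auto simp: power2_eq_square)
  qed
  have gen: "(s / (t - 1) - s / (t + 1)) / 2 = s / ((t - 1) * (t + 1))" if "t - 1 > 0" "t + 1 > 0" for t
    using that by (simp add: divide_simps) (simp add: algebra_simps)
  have D': "(D has_real_derivative (x - 1)\<^sup>2 * K x) (at x)" if x: "x \<ge> 4/5" for x
  proof -
    note p = pos[OF x]
    have p3: "s * x + 1 > 0" using p by simp
    have e1: "(s / (s * x - 1) - s / (s * x + 1)) / 2 = s / (2 * x\<^sup>2 - 1)"
    proof -
      have "(s / (s * x - 1) - s / (s * x + 1)) / 2 = s / ((s * x - 1) * (s * x + 1))"
        by (rule gen) (use p p3 in auto)
      also have "(s * x - 1) * (s * x + 1) = 2 * x\<^sup>2 - 1"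
        using s(1) by (simp add: algebra_simps power2_eq_square)
      finally show ?thesis .
    qed
    have "(D has_real_derivative (s / (s * x - 1) - s / (s * x + 1)) / 2 
        + (- (2 * x) * (s * x * (2 * x\<^sup>2 - 1)) - (1 - x\<^sup>2) * (s * (2 * x\<^sup>2 - 1) + s * x * (4 * x)))
             / (s * x * (2 * x\<^sup>2 - 1))\<^sup>2
        - 2 * (2 * x ^ 3 - x - 1) * (6 * x\<^sup>2 - 1) / (5 * s)) (at x)"
      unfolding D_def
    proof (intro DERIV_diff DERIV_add)
      show "((\<lambda>x. (ln (s * x - 1) - ln (s * x + 1)) / 2) has_real_derivative
          (s / (s * x - 1) - s / (s * x + 1)) / 2) (at x)"
      proof (intro DERIV_cdivide DERIV_diff)
        show "((\<lambda>x. ln (s * x - 1)) has_real_derivative s / (s * x - 1)) (at x)"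
          using p by (auto intro!: derivative_eq_intros)
        show "((\<lambda>x. ln (s * x + 1)) has_real_derivative s / (s * x + 1)) (at x)"
          using p3 by (auto intro!: derivative_eq_intros)
      qed
      have num: "((\<lambda>x. 1 - x\<^sup>2) has_real_derivative - (2 * x)) (at x)"
        by (auto intro!: derivative_eq_intros)
      have den: "((\<lambda>x. s * x * (2 * x\<^sup>2 - 1)) has_real_derivative
          s * (2 * x\<^sup>2 - 1) + s * x * (4 * x)) (at x)"
        by (auto intro!: derivative_eq_intros simp: algebra_simps)
      show "((\<lambda>x. (1 - x\<^sup>2) / (s * x * (2 * x\<^sup>2 - 1))) has_real_derivative
         (- (2 * x) * (s * x * (2 * x\<^sup>2 - 1)) - (1 - x\<^sup>2) * (s * (2 * x\<^sup>2 - 1) + s * x * (4 * x)))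
             / (s * x * (2 * x\<^sup>2 - 1))\<^sup>2) (at x)"
        using DERIV_divide[OF num den] p x s(2) by (auto simp: power2_eq_square[of "s * x * (2 * x\<^sup>2 - 1)"])
      show "((\<lambda>x. (2 * x ^ 3 - x - 1)\<^sup>2 / (5 * s)) has_real_derivative
          2 * (2 * x ^ 3 - x - 1) * (6 * x\<^sup>2 - 1) / (5 * s)) (at x)"
        using s(2) by (auto intro!: derivative_eq_intros)
    qed
    also have "(s / (s * x - 1) - s / (s * x + 1)) / 2 
        + (- (2 * x) * (s * x * (2 * x\<^sup>2 - 1)) - (1 - x\<^sup>2) * (s * (2 * x\<^sup>2 - 1) + s * x * (4 * x)))
             / (s * x * (2 * x\<^sup>2 - 1))\<^sup>2
        - 2 * (2 * x ^ 3 - x - 1) * (6 * x\<^sup>2 - 1) / (5 * s) = (x - 1)\<^sup>2 * K x"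
    proof -
      define y where "y = 2 * x\<^sup>2 - 1"
      have y: "y > 0" using p by (simp add: y_def)
      have x0: "x > 0" using x by simp
      have a: "s / y = 2 * 5 * x\<^sup>2 * y / (5 * s * x\<^sup>2 * y\<^sup>2)"
        using s y x0 by (simp add: field_simps power2_eq_square)
      have b: "(- (2 * x) * (s * x * y) - (1 - x\<^sup>2) * (s * y + s * x * (4 * x))) / (s * x * y)\<^sup>2
         = 5 * (- (2 * x) * (x * y) - (1 - x\<^sup>2) * (y + x * (4 * x))) / (5 * s * x\<^sup>2 * y\<^sup>2)"
        using s y x0 by (simp add: divide_simps power2_eq_square) (simp add: algebra_simps)
      have c: "2 * (2 * x ^ 3 - x - 1) * (6 * x\<^sup>2 - 1) / (5 * s)
         = 2 * (2 * x ^ 3 - x - 1) * (6 * x\<^sup>2 - 1) * x\<^sup>2 * y\<^sup>2 / (5 * s * x\<^sup>2 * y\<^sup>2)"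
        using s y x0 by simp
      show ?thesis
        unfolding e1 K_def y_def[symmetric] a b c add_divide_distrib[symmetric] diff_divide_distrib[symmetric]
          times_divide_eq_right
        by (rule arg_cong2[where f = "(/)"]) (simp_all add: y_def algebra_simps power_numeral_reduce)
    qed
    finally show ?thesis .
  qed
  have "continuous_on {4/5..6/5} K"
    unfolding K_def using pos s(2) by (force intro!: continuous_intros)
  hence "bounded (K ` {4/5..6/5})"
    by (intro compact_imp_bounded compact_continuous_image) auto
  then obtain C where C: "C > 0" "\<And>x. x \<in> {4/5..6/5} \<Longrightarrow> \<bar>K x\<bar> \<le> C"
    by (auto simp: bounded_pos)
  have D1: "D 1 = ln (sqrt 2 - 1)"
  proof -
    have "ln (s + 1) = - ln (s - 1)"
    proof -
      have "ln (s + 1) + ln (s - 1) = ln ((s + 1) * (s - 1))"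
        using s by (simp add: ln_mult)
      also have "(s + 1) * (s - 1) = 1" using s by (simp add: algebra_simps)
      finally show ?thesis by simp
    qed
    thus ?thesis by (simp add: D_def s_def[symmetric])
  qed
  have bound: "\<bar>D x - D 1\<bar> \<le> C * \<bar>x - 1\<bar> ^ 3" if x: "x \<in> {4/5..6/5}" for x
  proof -
    have "norm (D x - D 1) \<le> (C * \<bar>x - 1\<bar>\<^sup>2) * norm (x - 1)"
    proof (rule field_differentiable_bound[where S = "closed_segment 1 x" and f' = "\<lambda>x. (x - 1)\<^sup>2 * K x"])
      fix z assume z: "z \<in> closed_segment 1 x"
      hence z': "z \<in> {4/5..6/5}" "\<bar>z - 1\<bar> \<le> \<bar>x - 1\<bar>" using x
        by (auto simp: closed_segment_eq_real_ivl split: if_splits)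
      show "(D has_field_derivative (z - 1)\<^sup>2 * K z) (at z within closed_segment 1 x)"
        using D'[of z] z' by (auto intro: has_field_derivative_at_within)
      have "\<bar>z - 1\<bar>\<^sup>2 * \<bar>K z\<bar> \<le> \<bar>x - 1\<bar>\<^sup>2 * C"
        using z' C by (intro mult_mono power_mono) auto
      thus "norm ((z - 1)\<^sup>2 * K z) \<le> C * \<bar>x - 1\<bar>\<^sup>2"
        by (simp add: abs_mult mult.commute)
    qed auto
    thus ?thesis by (simp add: power3_eq_cube power2_eq_square mult.assoc)
  qed
  have "ln (rate (x / sqrt 2)) - (ln (sqrt 2 - 1) + (degree_ratio (x / sqrt 2) - 1)\<^sup>2 / (5 * sqrt 2)) = D x - D 1"
    if x: "x \<in> {4/5..6/5}" for x
  proof -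
    have x': "x \<ge> 4/5" using x by simp
    have px: "2 * (x / s) = s * x" using s by (simp add: field_simps)
    have px2: "(x / s)\<^sup>2 = x\<^sup>2 / 2" using s by (simp add: power_divide power2_eq_square)
    have "ln (rate (x / s)) = (ln (s * x - 1) - ln (s * x + 1)) / 2 + (1 - x\<^sup>2) / (s * x * (2 * x\<^sup>2 - 1))"
      using pos[OF x'] unfolding rate_def px px2
      by (simp add: ln_mult ln_sqrt ln_div)
    moreover have "degree_ratio (x / s) = 2 * x ^ 3 - x"
      unfolding degree_ratio_def px2 using s
      by (simp add: s_def[symmetric] algebra_simps power2_eq_square power3_eq_cube)
    ultimately show ?thesis
      unfolding D1 unfolding D_def by (simp add: s_def[symmetric])
  qed
  thus ?thesis using bound by metis
qed

section \<open>The phase on the vertical line through the saddle\<close>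
lemma saddle_alpha_ge: "saddle_alpha p \<ge> 2/5" if "p \<ge> 3/5" "p \<le> 4/5"
proof -
  have "p * p \<le> (4/5) * (4/5)" using that by (intro mult_mono) auto
  hence "p * (4 * p\<^sup>2 - 1) \<le> (4/5) * (39/25)"
    using that three_p_sq_gt_1[OF that(1)] by (intro mult_mono) (auto simp: power2_eq_square)
  thus ?thesis
    using that three_p_sq_gt_1[OF that(1)] by (auto simp: saddle_alpha_def field_simps)
qed

lemma saddle_modulus:
  assumes "p \<ge> 3/5"
  shows "norm (line_phase p (saddle p)) = rate p"
  unfolding line_phase_def H_e_saddle_alpha[OF assms, symmetric] H_e_def zeta_root_saddle_alpha[OF assms]
  by (simp add: norm_mult norm_divide norm_minus_commute add.commute mult.commute)

text \<open>
  Put \<open>s = y\<^sup>2\<close>, \<open>B = (1 + p)\<^sup>2\<close> and \<open>\<sigma> = s - S\<close>, where \<open>S\<close> is the value of \<open>s\<close> at the saddle. The squared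
  modulus is \<open>exp (2 \<alpha> (p\<^sup>2 - s))\<close> times a ratio of linear functions of \<open>s\<close>, and that ratio is its value at the
  saddle times \<open>1 + 2 \<sigma> / ((2 p - 1) (s + B))\<close>. Applying \<open>1 + x \<le> e\<^sup>x\<close> and the saddle equation
  \<open>\<alpha> (2 p - 1) (S + B) = 1\<close>, the terms linear in \<open>\<sigma>\<close> cancel and the exponent \<open>-2 \<alpha> \<sigma>\<^sup>2 / (s + B)\<close> is left.
  The constant \<open>1/200\<close> is a crude bound valid for all \<open>p\<close> in the interval,
  which is what makes the decay uniform in \<open>p\<close>.
\<close>
lemma line_modulus_le:
  assumes p: "p \<ge> 3/5" "p \<le> 4/5"
  shows "norm (line_phase p (Complex p y)) \<le> rate p * exp (- (\<bar>y\<bar> - Im (saddle p))\<^sup>2 / 200)" (is "?L \<le> ?R")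
proof -
  define r where "r = Im (saddle p)"
  define a where "a = saddle_alpha p"
  define s where "s = y\<^sup>2"
  define S where "S = 3 * p\<^sup>2 - 1"
  define B where "B = (1 + p)\<^sup>2"
  define \<sigma> where "\<sigma> = s - S"
  have r: "r\<^sup>2 = S" "r > 0" using saddle_Im_sq saddle_Im_pos p by (auto simp: r_def S_def)
  have a: "a \<ge> 2/5" using saddle_alpha_ge[OF p] by (simp add: a_def)
  have s0: "s \<ge> 0" by (simp add: s_def)
  have B0: "B > 0" using p by (simp add: B_def)
  have B1: "B \<le> 81/25"
    using mult_mono[of "1 + p" "9/5" "1 + p" "9/5"] p by (auto simp: B_def power2_eq_square)
  have S1: "S \<ge> 2/25"
    using mult_mono[of "3/5" p "3/5" p] p by (auto simp: S_def power2_eq_square)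
  have aS: "a * (2 * p - 1) * (S + B) = 1"
  proof -
    have "S + B = 2 * p * (2 * p + 1)" by (simp add: S_def B_def power2_eq_square algebra_simps)
    moreover have "4 * p\<^sup>2 - 1 = (2 * p - 1) * (2 * p + 1)" by (simp add: algebra_simps power2_eq_square)
    ultimately show ?thesis using p by (simp add: a_def saddle_alpha_def divide_simps)
  qed
  have ratio: "(s + (1 - p)\<^sup>2) / (s + B) = (2 * p - 1) / (2 * p + 1) * (1 + 2 * \<sigma> / ((2 * p - 1) * (s + B)))"
    using p s0 B0 by (simp add: divide_simps) (simp add: \<sigma>_def S_def B_def algebra_simps power2_eq_square)
  have "?L\<^sup>2 = exp (2 * a * (p\<^sup>2 - s)) * ((s + (1 - p)\<^sup>2) / (s + B))"
  proof -
    have "norm (exp (of_real a * (Complex p y)\<^sup>2)) = exp (a * (p\<^sup>2 - s))"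
      unfolding norm_exp_eq_Re by (simp add: s_def power2_eq_square)
    moreover have "(exp (a * (p\<^sup>2 - s)))\<^sup>2 = exp (2 * a * (p\<^sup>2 - s))"
      by (simp flip: exp_double)
    moreover have "(norm (1 - Complex p y))\<^sup>2 = s + (1 - p)\<^sup>2" "(norm (1 + Complex p y))\<^sup>2 = s + B"
      by (simp_all add: cmod_power2 s_def B_def)
    ultimately show ?thesis
      unfolding line_phase_def norm_mult norm_divide power_mult_distrib power_divide a_def[symmetric] by (simp only:)
  qed
  also have "\<dots> \<le> exp (2 * a * (p\<^sup>2 - s)) * ((2 * p - 1) / (2 * p + 1) * exp (2 * \<sigma> / ((2 * p - 1) * (s + B))))"
    unfolding ratio using p by (intro mult_left_mono exp_ge_add_one_self) auto
  also have "\<dots> = (2 * p - 1) / (2 * p + 1) * exp (2 * a * (p\<^sup>2 - s) + 2 * \<sigma> / ((2 * p - 1) * (s + B)))"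
    by (simp add: exp_add)
  also have "2 * a * (p\<^sup>2 - s) + 2 * \<sigma> / ((2 * p - 1) * (s + B)) = 2 * a * (p\<^sup>2 - S) - 2 * a * \<sigma>\<^sup>2 / (s + B)"
  proof -
    have "1 / (2 * p - 1) = a * (S + B)"
      using aS p by (simp add: field_simps)
    hence inv: "a * (S + B) = 1 / (2 * p - 1)" by simp
    have "2 * \<sigma> / ((2 * p - 1) * (s + B)) = 2 * \<sigma> * (a * (S + B)) / (s + B)"
      unfolding inv by simp
    also have "\<dots> = 2 * a * \<sigma> - 2 * a * \<sigma>\<^sup>2 / (s + B)"
      using s0 B0 by (simp add: field_simps \<sigma>_def power2_eq_square)
    finally show ?thesis by (simp add: \<sigma>_def algebra_simps)
  qed
  also have "(2 * p - 1) / (2 * p + 1) * exp \<dots> \<le> (2 * p - 1) / (2 * p + 1) * exp (2 * a * (p\<^sup>2 - S) - 2 * ((\<bar>y\<bar> - r)\<^sup>2 / 200))"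
  proof -
    have "(\<bar>y\<bar> - r)\<^sup>2 / 200 * (s + B) \<le> a * \<sigma>\<^sup>2"
    proof -
      have "\<sigma> = (\<bar>y\<bar> - r) * (\<bar>y\<bar> + r)"
        by (simp add: \<sigma>_def s_def r(1)[symmetric] algebra_simps power2_eq_square)
      hence eq: "a * \<sigma>\<^sup>2 = (\<bar>y\<bar> - r)\<^sup>2 * (a * (\<bar>y\<bar> + r)\<^sup>2)" by (simp add: power_mult_distrib)
      have "(s + B) / 200 \<le> 2/5 * (s + S)"
        using s0 B1 S1 by simp
      moreover have "2/5 * (s + S) \<le> a * (\<bar>y\<bar> + r)\<^sup>2"
      proof (rule mult_mono)
        show "s + S \<le> (\<bar>y\<bar> + r)\<^sup>2" using r by (simp add: s_def power2_sum)
      qed (use a s0 S1 in auto)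
      ultimately have "(s + B) / 200 \<le> a * (\<bar>y\<bar> + r)\<^sup>2" by linarith
      hence "(\<bar>y\<bar> - r)\<^sup>2 * ((s + B) / 200) \<le> (\<bar>y\<bar> - r)\<^sup>2 * (a * (\<bar>y\<bar> + r)\<^sup>2)"
        by (rule mult_left_mono) simp
      hence "(\<bar>y\<bar> - r)\<^sup>2 * ((s + B) / 200) \<le> a * \<sigma>\<^sup>2" unfolding eq .
      thus ?thesis by (simp add: mult.commute)
    qed
    hence "(\<bar>y\<bar> - r)\<^sup>2 / 200 \<le> a * \<sigma>\<^sup>2 / (s + B)"
      using s0 B0 by (simp add: field_simps)
    moreover have "2 * a * \<sigma>\<^sup>2 / (s + B) = 2 * (a * \<sigma>\<^sup>2 / (s + B))" by simp
    ultimately have "2 * a * (p\<^sup>2 - S) - 2 * a * \<sigma>\<^sup>2 / (s + B) \<le> 2 * a * (p\<^sup>2 - S) - 2 * ((\<bar>y\<bar> - r)\<^sup>2 / 200)"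
      by linarith
    thus ?thesis using p by (intro mult_left_mono) (simp_all only: exp_le_cancel_iff, auto)
  qed
  also have "\<dots> = ?R\<^sup>2"
  proof -
    have A: "2 * a * (p\<^sup>2 - S) = 2 * ((1 - 2 * p\<^sup>2) / (2 * p * (4 * p\<^sup>2 - 1)))"
    proof -
      have ps: "p\<^sup>2 - S = 1 - 2 * p\<^sup>2" by (simp add: S_def)
      show ?thesis
        unfolding ps a_def saddle_alpha_def by (simp only: mult.assoc times_divide_eq_left mult_1_left)
    qed
    have E: "exp (2 * x - 2 * y) = (exp x * exp (- y))\<^sup>2" for x y :: real
      by (simp flip: exp_add exp_double)
    have "exp (2 * a * (p\<^sup>2 - S) - 2 * ((\<bar>y\<bar> - r)\<^sup>2 / 200)) = 
        (exp ((1 - 2 * p\<^sup>2) / (2 * p * (4 * p\<^sup>2 - 1))) * exp (- (\<bar>y\<bar> - r)\<^sup>2 / 200))\<^sup>2"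
      unfolding A E minus_divide_left ..
    thus ?thesis using p
      by (simp add: rate_def power_mult_distrib r_def mult.assoc)
  qed
  finally show ?thesis
    by (rule power2_le_imp_le) (use rate_pos p in \<open>auto intro: less_imp_le\<close>)
qed

section \<open>Shifting vertical lines of integration\<close>

text \<open>
  The integrals along large rectangles between the two lines are assumed to have a common value \<open>V\<close>, so
  that the statement serves both for Cauchy's theorem (\<open>V = 0\<close>) and for Cauchy's formula. The horizontal
  sides contribute at most \<open>2 (c2 - c1) g R\<close>.
\<close>
lemma vertical_line_shift:
  fixes G :: "complex \<Rightarrow> complex"
  assumes "c1 \<le> c2"
    and V: "eventually (\<lambda>R. (G has_contour_integral V) (rectpath (Complex c1 (-R)) (Complex c2 R))) at_top"
    and int: "integrable lborel (\<lambda>y. G (Complex c1 y))" "integrable lborel (\<lambda>y. G (Complex c2 y))"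
    and g: "(g \<longlongrightarrow> 0) at_top"
    and decay: "\<And>x y. c1 \<le> x \<Longrightarrow> x \<le> c2 \<Longrightarrow> \<bar>y\<bar> \<ge> R0 \<Longrightarrow> norm (G (Complex x y)) \<le> g \<bar>y\<bar>"
  shows "V = \<i> * ((LINT y|lborel. G (Complex c2 y)) - (LINT y|lborel. G (Complex c1 y)))"
proof -
  define J where "J = (\<lambda>c R. integral {-R..R} (\<lambda>y. G (Complex c y)))"
  have J: "((\<lambda>R. J c R) \<longlongrightarrow> (LINT y|lborel. G (Complex c y))) at_top"
    if "integrable lborel (\<lambda>y. G (Complex c y))" for c
  proof -
    have "((\<lambda>R. LINT y|lborel. indicator {-R..R} y *\<^sub>R G (Complex c y)) \<longlongrightarrow> (LINT y|lborel. G (Complex c y))) at_top"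
    proof (rule integral_dominated_convergence_at_top[where w = "\<lambda>y. norm (G (Complex c y))"])
      show "AE y in lborel. ((\<lambda>R. indicator {-R..R} y *\<^sub>R G (Complex c y)) \<longlongrightarrow> G (Complex c y)) at_top"
      proof (rule AE_I2, rule tendsto_eventually)
        show "eventually (\<lambda>R. indicator {-R..R} y *\<^sub>R G (Complex c y) = G (Complex c y)) at_top" for y
          using eventually_ge_at_top[of "\<bar>y\<bar>"] by eventually_elim (auto simp: indicator_def)
      qed
    qed (use that in \<open>auto simp: indicator_def\<close>)
    also have "(\<lambda>R. LINT y|lborel. indicator {-R..R} y *\<^sub>R G (Complex c y)) = J c"
    proof
      fix R
      have "set_integrable lborel {-R..R} (\<lambda>y. G (Complex c y))"
        unfolding set_integrable_def using that by (intro integrable_mult_indicator) auto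
      from set_borel_integral_eq_integral(2)[OF this]
      show "(LINT y|lborel. indicator {-R..R} y *\<^sub>R G (Complex c y)) = J c R"
        by (simp add: J_def set_lebesgue_integral_def)
    qed
    finally show ?thesis .
  qed
  have "((\<lambda>R. V - \<i> * (J c2 R - J c1 R)) \<longlongrightarrow> 0) at_top"
  proof (rule Lim_null_comparison)
    show "((\<lambda>R. 2 * g R * (c2 - c1)) \<longlongrightarrow> 0) at_top"
      by (rule tendsto_eq_intros g refl | simp)+
    show "eventually (\<lambda>R. norm (V - \<i> * (J c2 R - J c1 R)) \<le> 2 * g R * (c2 - c1)) at_top"
      using V eventually_gt_at_top[of "max 1 R0"]
    proof eventually_elim
      case (elim R)
      hence R: "R > 0" "R \<ge> R0" by auto
      define a1 a2 a3 a4 where "a1 = Complex c1 (-R)" "a2 = Complex c2 (-R)" "a3 = Complex c2 R" "a4 = Complex c1 R"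
      note ad = this
      have *: "(G has_contour_integral V) (linepath a1 a2 +++ linepath a2 a3 +++ linepath a3 a4 +++ linepath a4 a1)"
        using elim(1) by (simp add: rectpath_def Let_def ad)
      hence "G contour_integrable_on (linepath a1 a2 +++ linepath a2 a3 +++ linepath a3 a4 +++ linepath a4 a1)"
        by (auto simp: contour_integrable_on_def)
      hence ci: "G contour_integrable_on linepath a1 a2" "G contour_integrable_on linepath a2 a3"
          "G contour_integrable_on linepath a3 a4" "G contour_integrable_on linepath a4 a1"
        by auto
      have sum: "V = contour_integral (linepath a1 a2) G + contour_integral (linepath a2 a3) G +
          contour_integral (linepath a3 a4) G + contour_integral (linepath a4 a1) G"
        using contour_integral_unique[OF *] ci by (simp add: contour_integrable_joinI add.assoc)
      have v2: "contour_integral (linepath a2 a3) G = \<i> * J c2 R"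
        unfolding J_def by (rule contour_integral_linepath_same_Re) (use R in \<open>auto simp: ad\<close>)
      have v4: "contour_integral (linepath a4 a1) G = - (\<i> * J c1 R)"
      proof -
        have "contour_integral (linepath a1 a4) G = \<i> * J c1 R"
          unfolding J_def by (rule contour_integral_linepath_same_Re) (use R in \<open>auto simp: ad\<close>)
        moreover have "contour_integral (linepath a4 a1) G = - contour_integral (linepath a1 a4) G"
          using contour_integral_reversepath[of "linepath a1 a4" G] by simp
        ultimately show ?thesis by simp
      qed
      have "norm (G (Complex c1 R)) \<le> g \<bar>R\<bar>" using R assms(1) by (intro decay) auto
      hence g0: "g R \<ge> 0" using R order_trans[OF norm_ge_zero] by simp
      have h1: "norm (contour_integral (linepath a1 a2) G) \<le> g R * norm (a2 - a1)"
      proof (rule has_contour_integral_bound_linepath)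
        show "(G has_contour_integral contour_integral (linepath a1 a2) G) (linepath a1 a2)"
          using ci by (simp add: has_contour_integral_integral)
        fix x assume "x \<in> closed_segment a1 a2"
        hence "Re x \<in> {c1..c2}" "Im x = -R" using assms(1)
          by (auto simp: closed_segment_same_Im ad closed_segment_eq_real_ivl split: if_splits)
        thus "norm (G x) \<le> g R" using decay[of "Re x" "Im x", unfolded complex.collapse] R by simp
      qed (use g0 in auto)
      have h3: "norm (contour_integral (linepath a3 a4) G) \<le> g R * norm (a4 - a3)"
      proof (rule has_contour_integral_bound_linepath)
        show "(G has_contour_integral contour_integral (linepath a3 a4) G) (linepath a3 a4)"
          using ci by (simp add: has_contour_integral_integral)
        fix x assume "x \<in> closed_segment a3 a4"
        hence "Re x \<in> {c1..c2}" "Im x = R" using assms(1)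
          by (auto simp: closed_segment_same_Im ad closed_segment_eq_real_ivl split: if_splits)
        thus "norm (G x) \<le> g R" using decay[of "Re x" "Im x", unfolded complex.collapse] R by simp
      qed (use g0 in auto)
      have n: "norm (a2 - a1) = c2 - c1" "norm (a4 - a3) = c2 - c1"
        using assms(1) by (auto simp: ad cmod_def)
      have "V - \<i> * (J c2 R - J c1 R) = contour_integral (linepath a1 a2) G + contour_integral (linepath a3 a4) G"
        using sum v2 v4 by (simp add: algebra_simps)
      also have "norm \<dots> \<le> g R * (c2 - c1) + g R * (c2 - c1)"
        using h1 h3 n by (intro norm_triangle_mono) auto
      finally show ?case by simp
    qed
  qed
  moreover have "((\<lambda>R. V - \<i> * (J c2 R - J c1 R)) \<longlongrightarrow>
      V - \<i> * ((LINT y|lborel. G (Complex c2 y)) - (LINT y|lborel. G (Complex c1 y)))) at_top"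
    by (intro tendsto_intros J int)
  ultimately have "V - \<i> * ((LINT y|lborel. G (Complex c2 y)) - (LINT y|lborel. G (Complex c1 y))) = 0"
    using tendsto_unique trivial_limit_at_top_linorder by blast
  thus ?thesis by simp
qed

section \<open>The approximation error as an infimum of suprema\<close>
lemma poly_norm_bound:
  fixes P :: "complex poly"
  assumes "degree P \<le> m"
  obtains C where "C \<ge> 0" "\<And>z. norm (poly P z) \<le> C * (1 + norm z) ^ m"
proof
  show "0 \<le> (\<Sum>i\<le>degree P. norm (coeff P i))" by (intro sum_nonneg) auto
  fix z :: complex
  have "norm (poly P z) \<le> (\<Sum>i\<le>degree P. norm (coeff P i * z ^ i))"
    unfolding poly_altdef by (rule norm_sum)
  also have "\<dots> \<le> (\<Sum>i\<le>degree P. norm (coeff P i) * (1 + norm z) ^ m)"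
  proof (rule sum_mono)
    fix i assume i: "i \<in> {..degree P}"
    have "norm z ^ i \<le> (1 + norm z) ^ i" by (intro power_mono) auto
    also have "\<dots> \<le> (1 + norm z) ^ m" using i assms by (intro power_increasing) auto
    finally show "norm (coeff P i * z ^ i) \<le> norm (coeff P i) * (1 + norm z) ^ m"
      by (simp add: norm_mult norm_power mult_left_mono)
  qed
  finally show "norm (poly P z) \<le> (\<Sum>i\<le>degree P. norm (coeff P i)) * (1 + norm z) ^ m"
    by (simp add: sum_distrib_right)
qed

text \<open>
  The denominator grows at least as fast as the numerator. Boundedness is what makes the real-valued
  supremum in \<open>rat_error\<close> a genuine one.
\<close>
lemma rat_class_bounded:
  assumes "q > 0" "r \<in> rat_class m q"
  shows "\<exists>B. \<forall>z\<le>0. norm (r (of_real z)) \<le> B"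
proof -
  obtain P where P: "r = (\<lambda>z. poly P z / (of_real q - z) ^ m)" "degree P \<le> m"
    using assms(2) by (auto simp: rat_class_def)
  obtain C where C: "C \<ge> 0" "\<And>z. norm (poly P z) \<le> C * (1 + norm z) ^ m"
    using poly_norm_bound[OF P(2)] by metis
  have "norm (r (of_real z)) \<le> C / min 1 q ^ m" if "z \<le> 0" for z :: real
  proof -
    have n: "norm (of_real q - of_real z :: complex) = q - z"
      using that assms(1) by (simp flip: of_real_diff)
    have "min 1 q * (1 - z) \<le> q - z"
    proof -
      have "min 1 q * (1 - z) = min 1 q + min 1 q * (- z)" by (simp add: algebra_simps)
      also have "\<dots> \<le> q + 1 * (- z)" using that by (intro add_mono mult_right_mono) auto
      finally show ?thesis by simp
    qed
    hence "(min 1 q * (1 - z)) ^ m \<le> (q - z) ^ m"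
      using that assms(1) by (intro power_mono) auto
    hence "min 1 q ^ m * (1 - z) ^ m \<le> (q - z) ^ m"
      by (simp only: power_mult_distrib)
    hence "(1 - z) ^ m \<le> (q - z) ^ m / min 1 q ^ m"
      using assms(1) by (simp add: pos_le_divide_eq mult.commute)
    hence "C * (1 - z) ^ m \<le> C * ((q - z) ^ m / min 1 q ^ m)" by (intro mult_left_mono C)
    moreover have "norm (poly P (of_real z)) \<le> C * (1 - z) ^ m"
      using C(2)[of "of_real z"] that by simp
    ultimately have "norm (poly P (of_real z)) \<le> C / min 1 q ^ m * (q - z) ^ m" by simp
    thus ?thesis using that assms(1)
      by (simp add: P(1) norm_divide norm_power n divide_le_eq)
  qed
  thus ?thesis by blast
qed

lemma rat_error_bdd_above:
  assumes "q > 0" "t > 0" "r \<in> rat_class m q"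
  shows "bdd_above ((\<lambda>z. cmod (exp (of_real (t * z)) - r (of_real z))) ` {..0})"
proof -
  obtain B where B: "\<And>z. z \<le> 0 \<Longrightarrow> norm (r (of_real z)) \<le> B"
    using rat_class_bounded[OF assms(1,3)] by blast
  show ?thesis
  proof (rule bdd_aboveI2)
    fix z :: real assume "z \<in> {..0}"
    hence z: "z \<le> 0" by simp
    have "norm (exp (complex_of_real (t * z)) - r (of_real z)) \<le> norm (exp (complex_of_real (t * z))) + norm (r (of_real z))"
      by (rule norm_triangle_ineq4)
    also have "\<dots> \<le> 1 + B"
      using z assms(2) B[OF z] by (intro add_mono) (auto simp: mult_nonneg_nonpos)
    finally show "cmod (exp (of_real (t * z)) - r (of_real z)) \<le> 1 + B" .
  qed
qed

lemma rat_error_le: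
  assumes "q > 0" "t > 0" "r \<in> rat_class m q"
    and "\<And>z. z \<le> 0 \<Longrightarrow> cmod (exp (of_real (t * z)) - r (of_real z)) \<le> B"
  shows "rat_error m t q \<le> B"
proof -
  have "0 \<le> (SUP z \<in> {..0 :: real}. cmod (exp (of_real (t * z)) - r (of_real z)))" if "r \<in> rat_class m q" for r
    by (rule cSUP_upper2[OF rat_error_bdd_above[OF assms(1,2) that], of 0]) auto
  hence "bdd_below ((\<lambda>r. SUP z \<in> {..0 :: real}. cmod (exp (of_real (t * z)) - r (of_real z))) ` rat_class m q)"
    by (intro bdd_belowI2)
  hence "rat_error m t q \<le> (SUP z \<in> {..0 :: real}. cmod (exp (of_real (t * z)) - r (of_real z)))"
    unfolding rat_error_def using assms(3) by (rule cINF_lower)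
  also have "\<dots> \<le> B"
    by (rule cSUP_least) (use assms(4) in auto)
  finally show ?thesis .
qed

lemma le_rat_error:
  assumes "q > 0" "t > 0"
    and "\<And>r E. r \<in> rat_class m q \<Longrightarrow>
      (\<And>z. z \<le> 0 \<Longrightarrow> cmod (exp (of_real (t * z)) - r (of_real z)) \<le> E) \<Longrightarrow> L \<le> E"
  shows "L \<le> rat_error m t q"
  unfolding rat_error_def
proof (rule cINF_greatest)
  have "(\<lambda>z. poly 0 z / (of_real q - z) ^ m) \<in> rat_class m q"
    unfolding rat_class_def by fastforce
  thus "rat_class m q \<noteq> {}" by blast
  fix r assume r: "r \<in> rat_class m q"
  show "L \<le> (SUP z \<in> {..0 :: real}. cmod (exp (of_real (t * z)) - r (of_real z)))"
    by (rule assms(3)[OF r], rule cSUP_upper[OF _ rat_error_bdd_above[OF assms(1,2) r]]) auto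
qed

text \<open>
  A polynomial in \<open>u = q / (q - z)\<close> of degree at most \<open>m\<close> has \<open>(q - z)\<^sup>m\<close> as a common denominator. The
  point \<open>z = q\<close> is excluded because both sides take the conventional values of division by zero there.
\<close>
lemma rat_class_of_poly:
  fixes Q :: "complex poly"
  assumes "degree Q \<le> m"
  obtains r where "r \<in> rat_class m q"
    "\<And>z. z \<noteq> of_real q \<Longrightarrow> r z = poly Q (of_real q / (of_real q - z))"
proof
  define P where "P = (\<Sum>j\<le>degree Q. smult (coeff Q j * of_real q ^ j) ([:of_real q, -1:] ^ (m - j)))"
  have "degree P \<le> m" unfolding P_def
  proof (rule degree_sum_le)
    fix j assume "j \<in> {..degree Q}"
    have "degree ([:of_real q, -1:] ^ (m - j) :: complex poly) \<le> 1 * (m - j)"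
      by (rule order_trans[OF degree_power_le]) simp
    thus "degree (smult (coeff Q j * of_real q ^ j) ([:of_real q, -1:] ^ (m - j))) \<le> m"
      using degree_smult_le order_trans by fastforce
  qed simp
  thus "(\<lambda>z. poly P z / (of_real q - z) ^ m) \<in> rat_class m q"
    by (auto simp: rat_class_def)
  fix z :: complex assume z: "z \<noteq> of_real q"
  have "poly P z / (of_real q - z) ^ m = (\<Sum>j\<le>degree Q. coeff Q j * of_real q ^ j * (of_real q - z) ^ (m - j) / (of_real q - z) ^ m)"
    by (simp add: P_def poly_sum sum_divide_distrib)
  also have "\<dots> = (\<Sum>j\<le>degree Q. coeff Q j * (of_real q / (of_real q - z)) ^ j)"
  proof (rule sum.cong)
    fix j assume "j \<in> {..degree Q}"
    hence "j \<le> m" using assms by auto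
    hence "(of_real q - z) ^ m = (of_real q - z) ^ (m - j) * (of_real q - z) ^ j"
      by (simp flip: power_add)
    thus "coeff Q j * of_real q ^ j * (of_real q - z) ^ (m - j) / (of_real q - z) ^ m =
        coeff Q j * (of_real q / (of_real q - z)) ^ j"
      using z by (simp add: power_divide)
  qed simp
  finally show "poly P z / (of_real q - z) ^ m = poly Q (of_real q / (of_real q - z))"
    by (simp add: poly_altdef)
qed

section \<open>Gaussian integrals on vertical lines\<close>
lemma integrable_gaussian:
  assumes "a > 0"
  shows "integrable lborel (\<lambda>y::real. exp (- a * (y - \<mu>)\<^sup>2))"
proof -
  define \<sigma> where "\<sigma> = 1 / sqrt (2 * a)"
  have \<sigma>: "\<sigma> > 0" "2 * \<sigma>\<^sup>2 = 1 / a" using assms by (auto simp: \<sigma>_def power_divide)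
  have "integrable lborel (\<lambda>y. sqrt (2 * pi * \<sigma>\<^sup>2) * normal_density \<mu> \<sigma> y)"
    using \<sigma> by (intro integrable_mult_right) auto
  also have "(\<lambda>y. sqrt (2 * pi * \<sigma>\<^sup>2) * normal_density \<mu> \<sigma> y) = (\<lambda>y. exp (- a * (y - \<mu>)\<^sup>2))"
    using \<sigma>(1) assms by (auto simp: normal_density_def \<sigma>(2))
  finally show ?thesis .
qed

lemma integrable_gaussian_dominated:
  fixes f :: "real \<Rightarrow> complex"
  assumes "a > 0" "continuous_on UNIV f" "\<And>y. norm (f y) \<le> C * exp (- a * y\<^sup>2)"
  shows "integrable lborel f"
proof (rule Bochner_Integration.integrable_bound)
  show "integrable lborel (\<lambda>y. C * exp (- a * y\<^sup>2))"
    using integrable_gaussian[OF assms(1), of 0] by (intro integrable_mult_right) simp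
  show "f \<in> borel_measurable lborel"
    using assms(2) borel_measurable_continuous_onI by simp
  have "norm (f y) \<le> norm (C * exp (- a * y\<^sup>2))" for y
    using assms(3)[of y] by simp
  thus "AE y in lborel. norm (f y) \<le> norm (C * exp (- a * y\<^sup>2))" by simp
qed

lemma norm_exp_line: "norm (exp (of_real a * (Complex c y)\<^sup>2)) = exp (a * c\<^sup>2) * exp (- a * y\<^sup>2)"
  unfolding norm_exp_eq_Re by (simp add: power2_eq_square algebra_simps flip: exp_add)

lemma continuous_on_Complex_line [continuous_intros]: "continuous_on S (\<lambda>y. Complex c y)"
  unfolding Complex_eq by (intro continuous_intros)

text \<open>
  Cauchy's formula at \<open>i v\<close> between the lines \<open>Re \<zeta> = \<plusminus>c\<close>. Because \<open>exp (a \<zeta>\<^sup>2)\<close> is even, reflecting the left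
  line onto the right one combines \<open>1 / (\<zeta> - i v)\<close> and \<open>1 / (\<zeta> + i v)\<close> into the kernel
  \<open>2 \<zeta> / (\<zeta>\<^sup>2 + v\<^sup>2)\<close>, which depends on \<open>v\<close> only through \<open>v\<^sup>2\<close>.
\<close>
lemma gaussian_cauchy_formula:
  fixes a c v :: real
  assumes a: "a > 0" and c: "c > 0"
  shows "integrable lborel (\<lambda>y. exp (of_real a * (Complex c y)\<^sup>2) * (2 * Complex c y / ((Complex c y)\<^sup>2 + of_real (v\<^sup>2))))"
    and "(LINT y|lborel. exp (of_real a * (Complex c y)\<^sup>2) * (2 * Complex c y / ((Complex c y)\<^sup>2 + of_real (v\<^sup>2)))) =
      of_real (2 * pi * exp (- a * v\<^sup>2))"
proof -
  define G where "G = (\<lambda>z. exp (of_real a * z\<^sup>2) / (z - \<i> * of_real v))"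
  have int: "integrable lborel (\<lambda>y. G (Complex d y))" if "\<bar>d\<bar> = c" for d
  proof (rule integrable_gaussian_dominated[OF a])
    have "Re (Complex d y - \<i> * of_real v) \<noteq> 0" for y using that c by auto
    hence "Complex d y - \<i> * of_real v \<noteq> 0" for y by (metis zero_complex.sel(1))
    thus "continuous_on UNIV (\<lambda>y. G (Complex d y))"
      unfolding G_def by (intro continuous_intros) auto
    fix y
    have "c \<le> norm (Complex d y - \<i> * of_real v)"
      using abs_Re_le_cmod[of "Complex d y - \<i> * of_real v"] that by simp
    hence "norm (G (Complex d y)) \<le> exp (a * d\<^sup>2) * exp (- a * y\<^sup>2) / c"
      unfolding G_def norm_divide norm_exp_line using c by (intro divide_left_mono mult_pos_pos) auto
    thus "norm (G (Complex d y)) \<le> exp (a * d\<^sup>2) / c * exp (- a * y\<^sup>2)" by simp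
  qed
  have main: "2 * pi * \<i> * exp (- of_real (a * v\<^sup>2)) =
      \<i> * ((LINT y|lborel. G (Complex c y)) - (LINT y|lborel. G (Complex (-c) y)))"
  proof (rule vertical_line_shift[where g = "\<lambda>R. exp (a * c\<^sup>2 - a * R\<^sup>2)" and ?R0.0 = "\<bar>v\<bar> + 1"])
    show "eventually (\<lambda>R. (G has_contour_integral (2 * pi * \<i> * exp (- of_real (a * v\<^sup>2)))) (rectpath (Complex (-c) (-R)) (Complex c R))) at_top"
      using eventually_gt_at_top[of "\<bar>v\<bar>"]
    proof eventually_elim
      case (elim R)
      have box: "\<i> * of_real v \<in> box (Complex (-c) (-R)) (Complex c R)"
        using elim c by (auto simp: in_box_complex_iff)
      have "((\<lambda>z. exp (of_real a * z\<^sup>2) / (z - \<i> * of_real v)) has_contour_integral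
          2 * pi * \<i> * winding_number (rectpath (Complex (-c) (-R)) (Complex c R)) (\<i> * of_real v) * exp (of_real a * (\<i> * of_real v)\<^sup>2))
          (rectpath (Complex (-c) (-R)) (Complex c R))"
      proof (rule Cauchy_integral_formula_convex_simple[where S = UNIV])
        have "path_image (rectpath (Complex (-c) (-R)) (Complex c R)) \<inter> box (Complex (-c) (-R)) (Complex c R) = {}"
          using c elim by (intro path_image_rectpath_inter_box) auto
        thus "path_image (rectpath (Complex (-c) (-R)) (Complex c R)) \<subseteq> UNIV - {\<i> * of_real v}"
          using box by auto
      qed (auto intro!: holomorphic_intros)
      thus ?case
        unfolding G_def winding_number_rectpath[OF box] by (simp add: power_mult_distrib)
    qed
    show "((\<lambda>R. exp (a * c\<^sup>2 - a * R\<^sup>2)) \<longlongrightarrow> 0) at_top"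
      using a by real_asymp
    fix x y assume xy: "- c \<le> x" "x \<le> c" "\<bar>y\<bar> \<ge> \<bar>v\<bar> + 1"
    have "norm (Complex x y - \<i> * of_real v) \<ge> 1"
      using abs_Im_le_cmod[of "Complex x y - \<i> * of_real v"] xy(3) by simp
    moreover have "x\<^sup>2 \<le> c\<^sup>2" using xy by (intro power2_le_iff_abs_le[THEN iffD2]) auto
    ultimately have "norm (G (Complex x y)) \<le> exp (a * x\<^sup>2) * exp (- a * y\<^sup>2) / 1"
      unfolding G_def norm_divide norm_exp_line by (intro divide_left_mono) auto
    also have "\<dots> \<le> exp (a * c\<^sup>2) * exp (- a * y\<^sup>2) / 1"
      using a \<open>x\<^sup>2 \<le> c\<^sup>2\<close> by (intro divide_right_mono mult_right_mono) auto
    finally show "norm (G (Complex x y)) \<le> exp (a * c\<^sup>2 - a * \<bar>y\<bar>\<^sup>2)"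
      by (simp flip: exp_add)
  qed (use c int in auto)
  have refl: "(LINT y|lborel. G (Complex (-c) y)) = (LINT y|lborel. G (- Complex c y))"
    using lborel_integral_real_affine[of "-1" "\<lambda>y. G (Complex (-c) y)" 0] by (simp add: Complex_eq)
  have intr: "integrable lborel (\<lambda>y. G (- Complex c y))"
    using lborel_integrable_real_affine[OF int[of "-c"], of "-1" 0] c by (simp add: Complex_eq)
  have eq: "G z - G (- z) = exp (of_real a * z\<^sup>2) * (2 * z / (z\<^sup>2 + of_real (v\<^sup>2)))" if "Re z = c" for z
  proof -
    have "Re (z - \<i> * of_real v) \<noteq> 0" "Re (z + \<i> * of_real v) \<noteq> 0" using that c by auto
    hence nz: "z - \<i> * of_real v \<noteq> 0" "z + \<i> * of_real v \<noteq> 0" by (metis zero_complex.sel(1))+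
    have fac: "z\<^sup>2 + of_real (v\<^sup>2) = (z - \<i> * of_real v) * (z + \<i> * of_real v)"
      by (simp add: power2_eq_square algebra_simps)
    have sum: "1 / (z - \<i> * of_real v) + 1 / (z + \<i> * of_real v) = 2 * z / (z\<^sup>2 + of_real (v\<^sup>2))"
      unfolding fac using nz by (simp add: divide_simps)
    have mm: "- z - \<i> * of_real v = - (z + \<i> * of_real v)" by simp
    have "G (- z) = exp (of_real a * z\<^sup>2) * (- (1 / (z + \<i> * of_real v)))"
      unfolding G_def power2_minus mm
      by (simp only: divide_minus_right mult_minus_right times_divide_eq_right mult_1_right)
    moreover have "G z = exp (of_real a * z\<^sup>2) * (1 / (z - \<i> * of_real v))"
      by (simp add: G_def)
    ultimately have "G z - G (- z) = exp (of_real a * z\<^sup>2) * (1 / (z - \<i> * of_real v) + 1 / (z + \<i> * of_real v))"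
      by (simp only: right_diff_distrib[symmetric] diff_minus_eq_add)
    thus ?thesis using sum by simp
  qed
  show "integrable lborel (\<lambda>y. exp (of_real a * (Complex c y)\<^sup>2) * (2 * Complex c y / ((Complex c y)\<^sup>2 + of_real (v\<^sup>2))))"
    using Bochner_Integration.integrable_diff[OF int[of c] intr] c by (simp add: eq)
  have "(LINT y|lborel. exp (of_real a * (Complex c y)\<^sup>2) * (2 * Complex c y / ((Complex c y)\<^sup>2 + of_real (v\<^sup>2))))
     = (LINT y|lborel. G (Complex c y)) - (LINT y|lborel. G (Complex (-c) y))"
    unfolding refl using Bochner_Integration.integral_diff[OF int[of c] intr] c by (simp add: eq)
  also have "\<dots> = of_real (2 * pi) * exp (- of_real (a * v\<^sup>2))"
    using main by (simp add: mult.assoc mult.left_commute[of _ \<i>])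
  also have "exp (- of_real (a * v\<^sup>2)) = complex_of_real (exp (- a * v\<^sup>2))"
    by (metis exp_of_real of_real_minus mult_minus_left)
  finally show "(LINT y|lborel. exp (of_real a * (Complex c y)\<^sup>2) * (2 * Complex c y / ((Complex c y)\<^sup>2 + of_real (v\<^sup>2)))) =
      of_real (2 * pi * exp (- a * v\<^sup>2))"
    by (simp only: of_real_mult)
qed

section \<open>Upper bound by a truncated Chebyshev expansion\<close>

text \<open>
  Chebyshev polynomials of the second kind on the interval from \<open>0\<close> to \<open>1\<close>, that is \<open>U\<^sub>n(2 u - 1)\<close>.
\<close>
fun chebU :: "nat \<Rightarrow> complex poly" where
  "chebU 0 = 1"
| "chebU (Suc 0) = [:-2, 4:]"
| "chebU (Suc (Suc n)) = [:-2, 4:] * chebU (Suc n) - chebU n"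

lemma degree_chebU: "degree (chebU n) \<le> n"
proof (induction n rule: chebU.induct)
  case (3 n)
  have "degree ([:-2, 4:] * chebU (Suc n)) \<le> 1 + Suc n"
    by (rule order_trans[OF degree_mult_le]) (use 3 in simp)
  thus ?case using 3 by (auto intro!: degree_diff_le)
qed auto

text \<open>
  The truncated generating function of the \<open>U\<^sub>n\<close>; the two extra terms are the remainder.
\<close>
lemma chebU_partial_sum:
  fixes w u :: complex
  defines "X \<equiv> 4 * u - 2"
  shows "(1 - X * w + w\<^sup>2) * (\<Sum>j\<le>k. w ^ j * poly (chebU j) u) =
    1 - w ^ Suc k * poly (chebU (Suc k)) u + w ^ Suc (Suc k) * poly (chebU k) u"
proof (induction k)
  case 0
  show ?case by (simp add: X_def algebra_simps power2_eq_square)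
next
  case (Suc k)
  have rec: "poly (chebU (Suc (Suc k))) u = X * poly (chebU (Suc k)) u - poly (chebU k) u"
    by (simp add: X_def algebra_simps)
  show ?case
    unfolding sum.atMost_Suc distrib_left Suc.IH rec
    by (simp add: algebra_simps power2_eq_square)
qed

text \<open>
  For \<open>w\<close> on the unit circle, \<open>U\<^sub>n\<close> at \<open>(w + 1 / w) / 2\<close> is the sum of the \<open>n + 1\<close> unimodular numbers
  \<open>w\<^sup>j w\<^sup>j\<^sup>-\<^sup>n\<close>. The recursion proved inside adds one of them at each step.
\<close>
lemma norm_chebU_le:
  fixes v :: real
  defines "u \<equiv> 1 / (1 + of_real (v\<^sup>2)) :: complex"
  shows "norm (poly (chebU n) u) \<le> n + 1"
proof -
  define w where "w = (1 - \<i> * of_real v) / (1 + \<i> * of_real v)"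
  define w' where "w' = (1 + \<i> * of_real v) / (1 - \<i> * of_real v)"
  have nz: "1 + \<i> * of_real v \<noteq> 0" "1 - \<i> * of_real v \<noteq> 0" by (auto simp: complex_eq_iff)
  have prod: "1 + complex_of_real (v\<^sup>2) = (1 + \<i> * of_real v) * (1 - \<i> * of_real v)"
    by (simp add: algebra_simps power2_eq_square)
  have ww: "w * w' = 1" using nz by (simp add: w_def w'_def)
  have X: "-2 + 4 * u = w + w'"
    unfolding u_def prod w_def w'_def using nz by (simp add: divide_simps) (simp add: algebra_simps)
  have "norm (1 - \<i> * of_real v) = norm (1 + \<i> * of_real v)" by (simp add: cmod_def)
  hence n: "norm w = 1" "norm w' = 1" using nz by (auto simp: w_def w'_def norm_divide)
  have step: "poly (chebU (Suc n)) u = w * poly (chebU n) u + w' ^ Suc n" for n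
  proof (induction n)
    case 0
    show ?case using X by (simp add: mult.commute)
  next
    case (Suc n)
    have "poly (chebU (Suc (Suc n))) u = (w + w') * poly (chebU (Suc n)) u - poly (chebU n) u"
      unfolding X[symmetric] by (simp add: algebra_simps)
    also have "\<dots> = w * poly (chebU (Suc n)) u + w' * (w * poly (chebU n) u + w' ^ Suc n) - poly (chebU n) u"
      unfolding Suc.IH[symmetric] by (simp add: algebra_simps del: chebU.simps)
    also have "w' * (w * poly (chebU n) u + w' ^ Suc n) = (w * w') * poly (chebU n) u + w' ^ Suc (Suc n)"
      by (simp add: algebra_simps)
    finally show ?case by (simp add: ww del: chebU.simps)
  qed
  show ?thesis
  proof (induction n)
    case (Suc n)
    have "norm (poly (chebU (Suc n)) u) \<le> norm (w * poly (chebU n) u) + norm (w' ^ Suc n)"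
      unfolding step by (rule norm_triangle_ineq)
    also have "\<dots> \<le> Suc n + 1" using Suc by (simp add: norm_mult norm_power n)
    finally show ?case .
  qed auto
qed

text \<open>
  The kernel of Cauchy's formula is \<open>8 \<zeta> u / (1 + \<zeta>)\<^sup>2\<close> times the generating function
  \<open>1 / (1 - 2 (2 u - 1) w + w\<^sup>2)\<close> of the \<open>U\<^sub>j\<close>. The factor \<open>u\<close> raises the degree by one, so the sum stops
  at \<open>k = m - 1\<close>. The remainder is the kernel itself times \<open>w\<^sup>m\<close> times a factor that grows only linearly
  in \<open>m\<close>.
\<close>
lemma kernel_expansion:
  fixes z :: complex and v :: real
  assumes "Re z > 0"
  defines "w \<equiv> (1 - z) / (1 + z)" and "u \<equiv> 1 / (1 + of_real (v\<^sup>2)) :: complex"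
  shows "2 * z / (z\<^sup>2 + of_real (v\<^sup>2)) - 8 * z / (1 + z)\<^sup>2 * u * (\<Sum>j\<le>k. w ^ j * poly (chebU j) u) =
    2 * z / (z\<^sup>2 + of_real (v\<^sup>2)) * (w ^ Suc k * (poly (chebU (Suc k)) u - w * poly (chebU k) u))"
proof -
  have "Re (z - \<i> * of_real v) \<noteq> 0" "Re (z + \<i> * of_real v) \<noteq> 0" "Re (1 + z) \<noteq> 0" using assms(1) by auto
  hence nz: "z - \<i> * of_real v \<noteq> 0" "z + \<i> * of_real v \<noteq> 0" "1 + z \<noteq> 0" by (metis zero_complex.sel(1))+
  have "z\<^sup>2 + of_real (v\<^sup>2) = (z - \<i> * of_real v) * (z + \<i> * of_real v)"
    by (simp add: power2_eq_square algebra_simps)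
  hence nz': "z\<^sup>2 + of_real (v\<^sup>2) \<noteq> 0" using nz by simp
  have v: "1 + complex_of_real (v\<^sup>2) \<noteq> 0"
    by (metis of_real_1 of_real_add of_real_eq_0_iff sum_power2_eq_zero_iff one_power2 zero_neq_one)
  have D: "1 - (4 * u - 2) * w + w\<^sup>2 = 4 * u * (z\<^sup>2 + of_real (v\<^sup>2)) / (1 + z)\<^sup>2"
    using nz v unfolding u_def w_def
    by (simp add: divide_simps) (simp add: algebra_simps power2_eq_square)
  have "8 * z / (1 + z)\<^sup>2 * u = 2 * z / (z\<^sup>2 + of_real (v\<^sup>2)) * (1 - (4 * u - 2) * w + w\<^sup>2)"
    unfolding D using nz' by simp
  hence "8 * z / (1 + z)\<^sup>2 * u * (\<Sum>j\<le>k. w ^ j * poly (chebU j) u) =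
    2 * z / (z\<^sup>2 + of_real (v\<^sup>2)) * ((1 - (4 * u - 2) * w + w\<^sup>2) * (\<Sum>j\<le>k. w ^ j * poly (chebU j) u))"
    by simp
  moreover define K where "K = 2 * z / (z\<^sup>2 + of_real (v\<^sup>2))"
  ultimately show ?thesis
    unfolding chebU_partial_sum K_def[symmetric] by (simp add: algebra_simps del: chebU.simps)
qed

lemma norm_cayley_le_1: "Re z \<ge> 0 \<Longrightarrow> norm ((1 - z) / (1 + z)) \<le> 1"
proof -
  assume z: "Re z \<ge> 0"
  have "(norm (1 - z))\<^sup>2 \<le> (norm (1 + z))\<^sup>2"
    unfolding cmod_power2 using z by (simp add: power2_eq_square algebra_simps)
  hence "norm (1 - z) \<le> norm (1 + z)" by (rule power2_le_imp_le) simp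
  thus ?thesis by (simp add: norm_divide divide_le_eq_1)
qed

text \<open>
  On all of the line the bound of \<open>line_modulus_le\<close> has one Gaussian bump at the saddle and one at its
  conjugate; their total mass does not depend on the position of the saddle.
\<close>
lemma integrable_two_bumps: "integrable lborel (\<lambda>y::real. exp (- (\<bar>y\<bar> - r)\<^sup>2 / 200))"
  and integral_two_bumps_le: "(LINT y|lborel. exp (- (\<bar>y\<bar> - r)\<^sup>2 / 200)) \<le> 2 * (LINT y|lborel. exp (- y\<^sup>2 / 200))"
proof -
  define g where "g = (\<lambda>y::real. exp (- y\<^sup>2 / 200))"
  have g: "integrable lborel g"
    using integrable_gaussian[of "1/200" 0] by (simp add: g_def)
  have g1: "integrable lborel (\<lambda>y. g (y - r))" "(LINT y|lborel. g (y - r)) = integral\<^sup>L lborel g"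
    using lborel_integrable_real_affine[OF g, of 1 "-r"] lborel_integral_real_affine[of 1 g "-r"] by auto
  have g2: "integrable lborel (\<lambda>y. g (y + r))" "(LINT y|lborel. g (y + r)) = integral\<^sup>L lborel g"
    using lborel_integrable_real_affine[OF g, of 1 "r"] lborel_integral_real_affine[of 1 g "r"] by (auto simp: add.commute)
  have le: "exp (- (\<bar>y\<bar> - r)\<^sup>2 / 200) \<le> g (y - r) + g (y + r)" for y
  proof (cases "y \<ge> 0")
    case False
    have "(- y - r)\<^sup>2 = (y + r)\<^sup>2" by (simp add: power2_eq_square algebra_simps)
    thus ?thesis using False by (simp add: g_def)
  qed (simp add: g_def)
  show int: "integrable lborel (\<lambda>y::real. exp (- (\<bar>y\<bar> - r)\<^sup>2 / 200))"
  proof (rule Bochner_Integration.integrable_bound)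
    show "integrable lborel (\<lambda>y. g (y - r) + g (y + r))" using g1 g2 by auto
    show "AE y in lborel. norm (exp (- (\<bar>y\<bar> - r)\<^sup>2 / 200)) \<le> norm (g (y - r) + g (y + r))"
      using le by (intro AE_I2) (auto intro: order_trans[OF _ abs_ge_self])
  qed measurable
  have "(LINT y|lborel. exp (- (\<bar>y\<bar> - r)\<^sup>2 / 200)) \<le> (LINT y|lborel. g (y - r) + g (y + r))"
    using g1 g2 le by (intro integral_mono int) auto
  also have "\<dots> = 2 * (LINT y|lborel. exp (- y\<^sup>2 / 200))"
    using g1 g2 by (simp add: g_def)
  finally show "(LINT y|lborel. exp (- (\<bar>y\<bar> - r)\<^sup>2 / 200)) \<le> 2 * (LINT y|lborel. exp (- y\<^sup>2 / 200))" .
qed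

text \<open>
  The approximant has the truncated expansion of the kernel integrated against \<open>exp (a \<zeta>\<^sup>2)\<close> over the
  line through the saddle. The Cauchy kernel is at most \<open>2 / p\<close> on this line, and only one of the \<open>m\<close>
  Gaussian factors of \<open>line_modulus_le\<close> is spent on integrability.
\<close>
lemma rat_error_upper:
  assumes p: "p \<ge> 3/5" "p \<le> 4/5" and t: "t > 0" and q: "q > 0" and m: "m > 0"
    and tq: "t * q = m * saddle_alpha p"
  shows "rat_error m t q \<le> 2 * (LINT y|lborel. exp (- y\<^sup>2 / 200)) * real (2 * m + 1) * rate p ^ m"
proof -
  obtain k where k: "m = Suc k" using m gr0_implies_Suc by blast
  define a where "a = t * q"
  define M where "M = (LINT y|lborel. exp (- y\<^sup>2 / 200 :: real))"
  have a: "a > 0" using t q by (simp add: a_def)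
  define w where "w = (\<lambda>y. (1 - Complex p y) / (1 + Complex p y))"
  have nz: "1 + Complex p y \<noteq> 0" for y using p by (auto simp: complex_eq_iff)
  have w1: "norm (w y) \<le> 1" for y unfolding w_def using p by (intro norm_cayley_le_1) auto
  have wcont: "continuous_on UNIV w" unfolding w_def using nz by (intro continuous_intros) auto
  define B where "B = (\<lambda>j y. exp (of_real a * (Complex p y)\<^sup>2) * (8 * Complex p y / (1 + Complex p y)\<^sup>2 * w y ^ j))"
  have intB: "integrable lborel (B j)" for j
  proof (rule integrable_gaussian_dominated[OF a])
    show "continuous_on UNIV (B j)"
      unfolding B_def using nz by (intro continuous_intros wcont) auto
    fix y
    have "norm (Complex p y) \<le> norm (1 + Complex p y)"
      using p by (auto simp: cmod_def intro!: power_mono)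
    moreover have "1 \<le> norm (1 + Complex p y)"
      using p abs_Re_le_cmod[of "1 + Complex p y"] by simp
    ultimately have "norm (Complex p y) * 1 \<le> norm (1 + Complex p y) * norm (1 + Complex p y)"
      by (intro mult_mono) auto
    hence "norm (8 * Complex p y / (1 + Complex p y)\<^sup>2) \<le> 8"
      using nz[of y] by (simp add: norm_divide norm_mult norm_power divide_le_eq power2_eq_square)
    moreover have "norm (w y ^ j) \<le> 1" using w1 by (simp add: norm_power power_le_one)
    ultimately have "norm (8 * Complex p y / (1 + Complex p y)\<^sup>2 * w y ^ j) \<le> 8 * 1"
      unfolding norm_mult[of _ "w y ^ j"] by (intro mult_mono) auto
    hence "norm (B j y) \<le> (exp (a * p\<^sup>2) * exp (- a * y\<^sup>2)) * 8"
      unfolding B_def norm_mult[of "exp _"] norm_exp_line by (intro mult_left_mono) auto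
    thus "norm (B j y) \<le> 8 * exp (a * p\<^sup>2) * exp (- a * y\<^sup>2)" by (simp add: mult_ac)
  qed
  define b where "b = (\<lambda>j. (LINT y|lborel. B j y) / of_real (2 * pi))"
  define Q where "Q = (\<Sum>j\<le>k. smult (b j) ([:0, 1:] * chebU j))"
  have "degree Q \<le> m" unfolding Q_def
  proof (rule degree_sum_le)
    fix j assume j: "j \<in> {..k}"
    have "degree ([:0, 1:] * chebU j) \<le> 1 + j"
      by (rule order_trans[OF degree_mult_le]) (use degree_chebU[of j] in simp)
    also have "\<dots> \<le> m" using j k by simp
    finally show "degree (smult (b j) ([:0, 1:] * chebU j)) \<le> m"
      using degree_smult_le order_trans by blast
  qed simp
  then obtain r where r: "r \<in> rat_class m q"
    "\<And>z. z \<noteq> of_real q \<Longrightarrow> r z = poly Q (of_real q / (of_real q - z))"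
    using rat_class_of_poly by blast
  show ?thesis
  proof (rule rat_error_le[OF q t r(1)])
    fix z :: real assume z: "z \<le> 0"
    define v where "v = sqrt (- z / q)"
    have v: "v\<^sup>2 = - z / q" using z q by (simp add: v_def divide_nonpos_pos)
    define u :: complex where "u = 1 / (1 + of_real (v\<^sup>2))"
    have ex: "t * z = - a * v\<^sup>2" unfolding v a_def using q by simp
    have u: "of_real q / (of_real q - of_real z) = u"
    proof -
      have "q / (q - z) = 1 / (1 + v\<^sup>2)" unfolding v using q z by (simp add: field_simps)
      hence "complex_of_real (q / (q - z)) = complex_of_real (1 / (1 + v\<^sup>2))" by (simp only:)
      thus ?thesis by (simp add: u_def)
    qed
    have rz: "r (of_real z) = poly Q u"
      using r(2)[of "of_real z"] z q u by simp
    define K where "K = (\<lambda>y. exp (of_real a * (Complex p y)\<^sup>2) * (2 * Complex p y / ((Complex p y)\<^sup>2 + of_real (v\<^sup>2))))"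
    have K: "integrable lborel K" "(LINT y|lborel. K y) = of_real (2 * pi * exp (- a * v\<^sup>2))"
      unfolding K_def using gaussian_cauchy_formula[OF a, of p v] p by auto
    define S where "S = (\<lambda>y. \<Sum>j\<le>k. B j y * (u * poly (chebU j) u))"
    have S: "integrable lborel S" unfolding S_def using intB by (intro Bochner_Integration.integrable_sum integrable_mult_left) auto
    have "(LINT y|lborel. S y) = (\<Sum>j\<le>k. of_real (2 * pi) * b j * (u * poly (chebU j) u))"
      unfolding S_def b_def using intB by (subst Bochner_Integration.integral_sum) auto
    also have "\<dots> = of_real (2 * pi) * poly Q u"
      by (simp add: Q_def poly_sum sum_distrib_left mult_ac)
    finally have Sint: "(LINT y|lborel. S y) = of_real (2 * pi) * poly Q u" .
    have "of_real (2 * pi) * (exp (of_real (t * z)) - r (of_real z)) = (LINT y|lborel. K y - S y)"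
      using K S Sint unfolding ex rz by (simp add: right_diff_distrib flip: exp_of_real)
    also have "norm \<dots> \<le> (LINT y|lborel. (rate p ^ m * (2 / p * (2 * m + 1))) * exp (- (\<bar>y\<bar> - Im (saddle p))\<^sup>2 / 200))"
    proof (rule Bochner_Integration.integral_norm_bound_integral)
      show "integrable lborel (\<lambda>y. K y - S y)" using K S by auto
      show "integrable lborel (\<lambda>y. (rate p ^ m * (2 / p * (2 * m + 1))) * exp (- (\<bar>y\<bar> - Im (saddle p))\<^sup>2 / 200))"
        by (intro integrable_mult_right integrable_two_bumps)
      fix y :: real
      define e where "e = line_phase p (Complex p y)"
      define s where "s = Complex p y"
      define g where "g = (\<bar>y\<bar> - Im (saddle p))\<^sup>2 / 200"
      have sRe: "Re s = p" by (simp add: s_def)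
      have am: "a = m * saddle_alpha p" using tq by (simp add: a_def)
      have em: "exp (of_real a * s\<^sup>2) * w y ^ m = e ^ m"
        unfolding e_def line_phase_def w_def power_mult_distrib exp_of_nat_mult[symmetric] am s_def by (simp add: mult.assoc)
      have "K y - S y = exp (of_real a * s\<^sup>2) * 
          (2 * s / (s\<^sup>2 + of_real (v\<^sup>2)) - 8 * s / (1 + s)\<^sup>2 * u * (\<Sum>j\<le>k. w y ^ j * poly (chebU j) u))"
      proof -
        have "S y = exp (of_real a * s\<^sup>2) * (8 * s / (1 + s)\<^sup>2 * u * (\<Sum>j\<le>k. w y ^ j * poly (chebU j) u))"
          unfolding S_def B_def s_def[symmetric] sum_distrib_left by (intro sum.cong) (simp_all add: mult_ac)
        thus ?thesis unfolding K_def s_def[symmetric] by (simp only: right_diff_distrib)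
      qed
      also have "\<dots> = exp (of_real a * s\<^sup>2) * (2 * s / (s\<^sup>2 + of_real (v\<^sup>2)) * (w y ^ m * (poly (chebU m) u - w y * poly (chebU k) u)))"
        unfolding k u_def w_def s_def[symmetric] by (subst kernel_expansion) (use p sRe in auto)
      also have "\<dots> = e ^ m * (2 * s / (s\<^sup>2 + of_real (v\<^sup>2))) * (poly (chebU m) u - w y * poly (chebU k) u)"
        by (simp add: em[symmetric] mult_ac)
      finally have KS: "K y - S y = \<dots>" .
      have "norm e \<le> rate p * exp (- g)"
        unfolding e_def g_def using line_modulus_le[OF p, of y] by simp
      hence "norm (e ^ m) \<le> (rate p * exp (- g)) ^ m"
        unfolding norm_power by (intro power_mono) auto
      also have "\<dots> \<le> rate p ^ m * exp (- g)"
      proof -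
        have "exp (- g) ^ m \<le> exp (- g) ^ 1" using m by (intro power_decreasing) (auto simp: g_def)
        thus ?thesis using rate_pos[OF p(1)] by (simp add: power_mult_distrib)
      qed
      finally have b1: "norm (e ^ m) \<le> rate p ^ m * exp (- g)" .
      have b2: "norm (2 * s / (s\<^sup>2 + of_real (v\<^sup>2))) \<le> 2 / p"
      proof -
        have fac: "s\<^sup>2 + of_real (v\<^sup>2) = (s - \<i> * of_real v) * (s + \<i> * of_real v)"
          by (simp add: power2_eq_square algebra_simps)
        have "norm (s - \<i> * of_real v) \<ge> p" "norm (s + \<i> * of_real v) \<ge> p"
          using abs_Re_le_cmod[of "s - \<i> * of_real v"] abs_Re_le_cmod[of "s + \<i> * of_real v"] p by (auto simp: sRe)
        hence n: "norm (1 / (s - \<i> * of_real v)) \<le> 1 / p" "norm (1 / (s + \<i> * of_real v)) \<le> 1 / p"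
            "s - \<i> * of_real v \<noteq> 0" "s + \<i> * of_real v \<noteq> 0"
          using p by (auto simp: norm_divide intro!: divide_left_mono mult_pos_pos)
        have "2 * s / (s\<^sup>2 + of_real (v\<^sup>2)) = 1 / (s - \<i> * of_real v) + 1 / (s + \<i> * of_real v)"
          unfolding fac using n by (simp add: divide_simps)
        also have "norm \<dots> \<le> 1 / p + 1 / p" using n by (intro norm_triangle_mono)
        finally show ?thesis by simp
      qed
      have b3: "norm (poly (chebU m) u - w y * poly (chebU k) u) \<le> 2 * m + 1"
      proof -
        have "norm (w y * poly (chebU k) u) \<le> 1 * real (k + 1)"
          unfolding norm_mult using norm_chebU_le[of k v] w1[of y] by (intro mult_mono) (auto simp: u_def)
        moreover have "norm (poly (chebU m) u) \<le> m + 1"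
          using norm_chebU_le[of m v] by (simp add: u_def)
        ultimately show ?thesis
          using norm_triangle_ineq4[of "poly (chebU m) u" "w y * poly (chebU k) u"] k by simp
      qed
      have "norm (K y - S y) \<le> (rate p ^ m * exp (- g)) * (2 / p) * (2 * m + 1)"
        unfolding KS norm_mult[of "e ^ m * _"] norm_mult[of "e ^ m"]
        by (intro mult_mono b1 b2 b3) (use p rate_pos[of p] in auto)
      thus "norm (K y - S y) \<le> (rate p ^ m * (2 / p * (2 * m + 1))) * exp (- (\<bar>y\<bar> - Im (saddle p))\<^sup>2 / 200)"
        unfolding g_def minus_divide_left by (simp only: mult_ac)
    qed
    also have "\<dots> = (rate p ^ m * (2 / p * (2 * m + 1))) * (LINT y|lborel. exp (- (\<bar>y\<bar> - Im (saddle p))\<^sup>2 / 200))"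
      by simp
    also have "\<dots> \<le> (rate p ^ m * (2 / p * (2 * m + 1))) * (2 * M)"
      unfolding M_def using p rate_pos[of p] by (intro mult_left_mono integral_two_bumps_le) auto
    finally have "2 * pi * norm (exp (complex_of_real (t * z)) - r (of_real z)) \<le> (rate p ^ m * (2 / p * (2 * m + 1))) * (2 * M)"
      by (simp add: norm_mult)
    also have "\<dots> = (2 / p) * (M * (2 * m + 1) * rate p ^ m * 2)" by simp
    also have "\<dots> \<le> (2 * pi) * (M * (2 * m + 1) * rate p ^ m * 2)"
    proof (rule mult_right_mono)
      have "2 / p \<le> 4" using p by (simp add: field_simps)
      thus "2 / p \<le> 2 * pi" using pi_gt3 by linarith
      have "M \<ge> 0" unfolding M_def by (intro integral_nonneg_AE) auto
      thus "0 \<le> M * (2 * m + 1) * rate p ^ m * 2" using rate_pos[OF p(1)] by simp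
    qed
    finally show "cmod (exp (complex_of_real (t * z)) - r (of_real z)) \<le> 2 * (LINT y|lborel. exp (- y\<^sup>2 / 200)) * real (2 * m + 1) * rate p ^ m"
      by (simp add: M_def mult_ac)
  qed
qed

section \<open>A functional that annihilates the rational class\<close>
lemma integrable_inverse_one_plus_square:
  shows "integrable lborel (\<lambda>y::real. 1 / (1 + y\<^sup>2))"
    and "(LINT y|lborel. 1 / (1 + y\<^sup>2)) = pi"
  using integrable_inverse_1_plus_square LBINT_inverse_1_plus_square
  by (simp_all add: set_integrable_def interval_lebesgue_integral_def set_lebesgue_integral_def inverse_eq_divide)

lemma norm_one_plus_ge:
  assumes "Re z \<ge> 0"
  shows "(norm (1 + z))\<^sup>2 \<ge> 1 + (norm z)\<^sup>2" "(norm (1 + z))\<^sup>2 \<ge> 1 + (Im z)\<^sup>2" 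
    "(norm (1 + z))\<^sup>2 \<ge> (1 + Re z)\<^sup>2" "norm (1 + z) > 0"
proof -
  show "(norm (1 + z))\<^sup>2 \<ge> 1 + (norm z)\<^sup>2" "(norm (1 + z))\<^sup>2 \<ge> 1 + (Im z)\<^sup>2" "(norm (1 + z))\<^sup>2 \<ge> (1 + Re z)\<^sup>2"
    unfolding cmod_power2 using assms by (auto simp: power2_eq_square algebra_simps)
  thus "norm (1 + z) > 0" using assms by (auto simp: complex_eq_iff)
qed

text \<open>
  The weight is \<open>w\<^sup>k\<^sup>+\<^sup>1 / (1 - \<zeta>\<^sup>2)\<close>, written so that its zero at \<open>\<zeta> = 1\<close> is visible: it is holomorphic on the
  right half-plane, and on the imaginary axis its modulus is \<open>1 / (1 + y\<^sup>2)\<close>.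
\<close>
lemma norm_cayley_weight_le:
  assumes "Re z \<ge> 0"
  shows "norm ((1 - z) ^ k / (1 + z) ^ (k + 2)) \<le> 1 / (norm (1 + z))\<^sup>2"
proof -
  have "norm ((1 - z) ^ k / (1 + z) ^ (k + 2)) = norm ((1 - z) / (1 + z)) ^ k * (1 / (norm (1 + z))\<^sup>2)"
    by (simp add: norm_divide norm_mult norm_power power_divide power_add power2_eq_square)
  also have "\<dots> \<le> 1 ^ k * (1 / (norm (1 + z))\<^sup>2)"
    using norm_cayley_le_1[OF assms] by (intro mult_right_mono power_mono) auto
  finally show ?thesis by simp
qed

lemma half_plane_contour_integral_0:
  assumes "f holomorphic_on {z. Re z > -1}" "0 \<le> c" "R \<ge> 0"
  shows "(f has_contour_integral 0) (rectpath (Complex 0 (-R)) (Complex c R))"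
proof (rule Cauchy_theorem_convex_simple[OF assms(1)])
  show "convex {z. Re z > -1}" by (rule convex_halfspace_Re_gt)
  show "path_image (rectpath (Complex 0 (-R)) (Complex c R)) \<subseteq> {z. Re z > -1}"
    using assms(2,3) by (auto simp: path_image_rectpath)
qed auto

lemma gaussian_weight_shift:
  fixes a c :: real and k :: nat
  assumes a: "a > 0" and c: "c \<ge> 0"
  defines "H \<equiv> (\<lambda>z. exp (of_real a * z\<^sup>2) * ((1 - z) ^ k / (1 + z) ^ (k + 2)))"
  shows "integrable lborel (\<lambda>y. H (Complex c y))" "(LINT y|lborel. H (Complex c y)) = (LINT y|lborel. H (Complex 0 y))"
proof -
  have nz: "1 + z \<noteq> 0" if "Re z > -1" for z using that by (auto simp: complex_eq_iff)
  have bound: "norm (H (Complex x y)) \<le> exp (a * x\<^sup>2) * exp (- a * y\<^sup>2)" if "x \<ge> 0" for x y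
  proof -
    have "norm ((1 - Complex x y) ^ k / (1 + Complex x y) ^ (k + 2)) \<le> 1 / (norm (1 + Complex x y))\<^sup>2"
      using that by (intro norm_cayley_weight_le) auto
    also have "\<dots> \<le> 1"
    proof -
      have "1 + y\<^sup>2 \<le> (norm (1 + Complex x y))\<^sup>2"
        using norm_one_plus_ge(2)[of "Complex x y"] that by simp
      hence "1 \<le> (norm (1 + Complex x y))\<^sup>2" by (rule order_trans[rotated]) simp
      thus ?thesis by (simp add: divide_le_eq_1)
    qed
    finally show ?thesis
      unfolding H_def norm_mult[of "exp _"] norm_exp_line
      using mult_left_mono[of _ 1 "exp (a * x\<^sup>2) * exp (- a * y\<^sup>2)"] by simp
  qed
  have int: "integrable lborel (\<lambda>y. H (Complex x y))" if "x \<ge> 0" for x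
  proof (rule integrable_gaussian_dominated[OF a _ bound[OF that]])
    have "1 + Complex x y \<noteq> 0" for y using that by (intro nz) auto
    thus "continuous_on UNIV (\<lambda>y. H (Complex x y))"
      unfolding H_def by (intro continuous_intros) auto
  qed
  show "integrable lborel (\<lambda>y. H (Complex c y))" using c by (rule int)
  have "0 = \<i> * ((LINT y|lborel. H (Complex c y)) - (LINT y|lborel. H (Complex 0 y)))"
  proof (rule vertical_line_shift[where g = "\<lambda>R. exp (a * c\<^sup>2 - a * R\<^sup>2)" and ?R0.0 = 0])
    have "H holomorphic_on {z. Re z > -1}"
      unfolding H_def using nz by (intro holomorphic_intros) auto
    thus "eventually (\<lambda>R. (H has_contour_integral 0) (rectpath (Complex 0 (-R)) (Complex c R))) at_top"
      using c by (intro eventually_mono[OF eventually_ge_at_top[of 0]] half_plane_contour_integral_0)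
    show "((\<lambda>R. exp (a * c\<^sup>2 - a * R\<^sup>2)) \<longlongrightarrow> 0) at_top"
      using a by real_asymp
    fix x y assume xy: "0 \<le> x" "x \<le> c"
    hence "x\<^sup>2 \<le> c\<^sup>2" by (intro power_mono)
    hence "exp (a * x\<^sup>2) * exp (- a * y\<^sup>2) \<le> exp (a * c\<^sup>2 - a * \<bar>y\<bar>\<^sup>2)"
      using a by (simp flip: exp_add)
    thus "norm (H (Complex x y)) \<le> exp (a * c\<^sup>2 - a * \<bar>y\<bar>\<^sup>2)"
      using bound[OF xy(1)] order_trans by blast
  qed (use c int in auto)
  thus "(LINT y|lborel. H (Complex c y)) = (LINT y|lborel. H (Complex 0 y))" by simp
qed

text \<open>
  The pole of the rational function at \<open>z = q\<close> becomes a pole of order \<open>m\<close> at \<open>\<zeta> = 1\<close>, which the zero of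
  order \<open>k \<ge> m\<close> of the weight absorbs. The product is then holomorphic on the right half-plane and
  \<open>O(1 / \<bar>1 + \<zeta>\<bar>\<^sup>2)\<close>; moving the line of integration to infinity shows that its integral is \<open>0\<close>.
\<close>
lemma rational_weight_annihilation:
  fixes P :: "complex poly"
  assumes "degree P \<le> m" "q > 0" "m \<le> k"
  defines "R \<equiv> (\<lambda>z. poly P (of_real q * z\<^sup>2) / of_real q ^ m * (1 - z) ^ (k - m) / (1 + z) ^ (k + 2 + m))"
  shows "integrable lborel (\<lambda>y. R (Complex 0 y))" "(LINT y|lborel. R (Complex 0 y)) = 0"
proof -
  have nz: "1 + z \<noteq> 0" if "Re z > -1" for z using that by (auto simp: complex_eq_iff)
  obtain C where C: "C \<ge> 0" "\<And>z. norm (poly P z) \<le> C * (1 + norm z) ^ m"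
    using poly_norm_bound[OF assms(1)] by metis
  define D where "D = C * (1 + q) ^ m / q ^ m"
  have D: "D \<ge> 0" using C assms(2) by (simp add: D_def)
  have bound: "norm (R z) \<le> D / (norm (1 + z))\<^sup>2" if z: "Re z \<ge> 0" for z
  proof -
    note n = norm_one_plus_ge[OF z]
    have "norm (poly P (of_real q * z\<^sup>2)) \<le> C * (1 + q * (norm z)\<^sup>2) ^ m"
      using C(2)[of "of_real q * z\<^sup>2"] assms(2) by (simp add: norm_mult norm_power)
    also have "\<dots> \<le> C * ((1 + q) * (norm (1 + z))\<^sup>2) ^ m"
    proof (intro mult_left_mono power_mono C)
      have "1 + q * (norm z)\<^sup>2 \<le> (1 + q) * (1 + (norm z)\<^sup>2)"
        using assms(2) by (simp add: algebra_simps)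
      also have "\<dots> \<le> (1 + q) * (norm (1 + z))\<^sup>2" using n assms(2) by (intro mult_left_mono) auto
      finally show "1 + q * (norm z)\<^sup>2 \<le> (1 + q) * (norm (1 + z))\<^sup>2" .
    qed (use assms(2) in auto)
    finally have 1: "norm (poly P (of_real q * z\<^sup>2)) \<le> C * (1 + q) ^ m * norm (1 + z) ^ (2 * m)"
      by (simp add: power_mult_distrib mult.assoc flip: power_mult)
    have "norm (1 - z) ^ (k - m) \<le> norm (1 + z) ^ (k - m)"
      using norm_cayley_le_1[OF z] n(4) by (intro power_mono) (auto simp: norm_divide divide_le_eq_1)
    with 1 have "norm (poly P (of_real q * z\<^sup>2)) * norm (1 - z) ^ (k - m) \<le> 
        (C * (1 + q) ^ m * norm (1 + z) ^ (2 * m)) * norm (1 + z) ^ (k - m)"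
      using C assms(2) by (intro mult_mono) auto
    hence "norm (R z) \<le> (C * (1 + q) ^ m * norm (1 + z) ^ (2 * m)) * norm (1 + z) ^ (k - m) / (q ^ m * norm (1 + z) ^ (k + 2 + m))"
      unfolding R_def norm_divide norm_mult norm_power using assms(2) by (simp add: divide_right_mono)
    also have "k + 2 + m = 2 * m + (k - m) + 2" using assms(3) by simp
    also have "(C * (1 + q) ^ m * norm (1 + z) ^ (2 * m)) * norm (1 + z) ^ (k - m) / (q ^ m * norm (1 + z) ^ (2 * m + (k - m) + 2)) =
       D / (norm (1 + z))\<^sup>2"
      unfolding power_add D_def using n(4) assms(2) by (simp add: field_simps)
    finally show ?thesis .
  qed
  have bound': "norm (R (Complex x y)) \<le> D * (1 / (1 + y\<^sup>2))" if "x \<ge> 0" for x y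
  proof -
    have "D / (norm (1 + Complex x y))\<^sup>2 \<le> D / (1 + y\<^sup>2)"
      using norm_one_plus_ge[of "Complex x y"] that D
      by (intro divide_left_mono mult_pos_pos) (auto intro: add_pos_nonneg)
    thus ?thesis using bound[of "Complex x y"] that by simp
  qed
  have cont: "continuous_on UNIV (\<lambda>y. R (Complex x y))" if "x \<ge> 0" for x
  proof -
    have "1 + Complex x y \<noteq> 0" for y using that by (intro nz) auto
    thus ?thesis unfolding R_def using assms(2) by (intro continuous_intros) auto
  qed
  have int: "integrable lborel (\<lambda>y. R (Complex x y))" if "x \<ge> 0" for x
  proof (rule Bochner_Integration.integrable_bound)
    show "integrable lborel (\<lambda>y::real. D * (1 / (1 + y\<^sup>2)))"
      by (intro integrable_mult_right integrable_inverse_one_plus_square)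
    show "(\<lambda>y. R (Complex x y)) \<in> borel_measurable lborel"
      using cont[OF that] borel_measurable_continuous_onI by simp
    show "AE y in lborel. norm (R (Complex x y)) \<le> norm (D * (1 / (1 + y\<^sup>2)))"
      using bound'[OF that] by (intro AE_I2) (metis abs_ge_self order_trans real_norm_def)
  qed
  show "integrable lborel (\<lambda>y. R (Complex 0 y))" by (rule int) simp
  have shift: "(LINT y|lborel. R (Complex c y)) = (LINT y|lborel. R (Complex 0 y))" if c: "c \<ge> 0" for c
  proof -
    have "0 = \<i> * ((LINT y|lborel. R (Complex c y)) - (LINT y|lborel. R (Complex 0 y)))"
    proof (rule vertical_line_shift[where g = "\<lambda>y. D * (1 / (1 + y\<^sup>2))" and ?R0.0 = 0])
      have "R holomorphic_on {z. Re z > -1}"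
        unfolding R_def using nz assms(2) by (intro holomorphic_intros) auto
      thus "eventually (\<lambda>y. (R has_contour_integral 0) (rectpath (Complex 0 (-y)) (Complex c y))) at_top"
        using c by (intro eventually_mono[OF eventually_ge_at_top[of 0]] half_plane_contour_integral_0)
      show "((\<lambda>y. D * (1 / (1 + y\<^sup>2))) \<longlongrightarrow> 0) at_top"
        by real_asymp
    qed (use c int bound' in auto)
    thus ?thesis by simp
  qed
  have "(\<lambda>n. LINT y|lborel. R (Complex (real n) y)) \<longlonglongrightarrow> (LINT (y::real)|lborel. (0 :: complex))"
  proof (rule integral_dominated_convergence[where w = "\<lambda>y. D * (1 / (1 + y\<^sup>2))"])
    show "integrable lborel (\<lambda>y::real. D * (1 / (1 + y\<^sup>2)))"
      by (intro integrable_mult_right integrable_inverse_one_plus_square)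
    show "AE y in lborel. (\<lambda>n. R (Complex (real n) y)) \<longlonglongrightarrow> 0"
    proof (rule AE_I2, rule Lim_null_comparison)
      fix y :: real
      show "(\<lambda>n. D / (1 + real n)\<^sup>2) \<longlonglongrightarrow> 0" by real_asymp
      have "norm (R (Complex (real n) y)) \<le> D / (1 + real n)\<^sup>2" for n
      proof -
        have "D / (norm (1 + Complex (real n) y))\<^sup>2 \<le> D / (1 + real n)\<^sup>2"
          using norm_one_plus_ge[of "Complex (real n) y"] D
          by (intro divide_left_mono mult_pos_pos) auto
        thus ?thesis using bound[of "Complex (real n) y"] by simp
      qed
      thus "eventually (\<lambda>n. norm (R (Complex (real n) y)) \<le> D / (1 + real n)\<^sup>2) sequentially" by simp
    qed
    show "(\<lambda>y. R (Complex (real n) y)) \<in> borel_measurable lborel" for n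
      using int[of "real n"] by auto
    show "AE y in lborel. norm (R (Complex (real n) y)) \<le> D * (1 / (1 + y\<^sup>2))" for n
      using bound'[of "real n"] by simp
  qed auto
  moreover have "(\<lambda>n. LINT y|lborel. R (Complex (real n) y)) = (\<lambda>n. LINT y|lborel. R (Complex 0 y))"
    by (rule ext, rule shift) simp
  ultimately have "(\<lambda>n::nat. LINT y|lborel. R (Complex 0 y)) \<longlonglongrightarrow> (LINT (y::real)|lborel. (0 :: complex))"
    by (simp only:)
  thus "(LINT y|lborel. R (Complex 0 y)) = 0" by (simp add: LIMSEQ_const_iff)
qed

text \<open>
  The duality estimate: on the imaginary axis the exponential may be replaced by its difference to \<open>r\<close>,
  whose modulus is at most \<open>E\<close>, while the total mass of the weight is \<open>\<pi>\<close>.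
\<close>
lemma contour_functional_le_error:
  assumes q: "q > 0" and t: "t > 0" and k: "m \<le> k" and c: "c \<ge> 0"
    and r: "r \<in> rat_class m q"
    and E: "\<And>z. z \<le> 0 \<Longrightarrow> cmod (exp (of_real (t * z)) - r (of_real z)) \<le> E"
  shows "norm (LINT y|lborel. exp (of_real (t * q) * (Complex c y)\<^sup>2) * ((1 - Complex c y) ^ k / (1 + Complex c y) ^ (k + 2))) \<le> pi * E"
proof -
  obtain P where P: "r = (\<lambda>z. poly P z / (of_real q - z) ^ m)" "degree P \<le> m"
    using r by (auto simp: rat_class_def)
  define H where "H = (\<lambda>z::complex. exp (of_real (t * q) * z\<^sup>2) * ((1 - z) ^ k / (1 + z) ^ (k + 2)))"
  define R where "R = (\<lambda>z::complex. poly P (of_real q * z\<^sup>2) / of_real q ^ m * (1 - z) ^ (k - m) / (1 + z) ^ (k + 2 + m))"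
  have tq: "t * q > 0" using t q by simp
  have H: "integrable lborel (\<lambda>y. H (Complex 0 y))"
      "(LINT y|lborel. H (Complex c y)) = (LINT y|lborel. H (Complex 0 y))"
    unfolding H_def using gaussian_weight_shift[OF tq, of 0 k] gaussian_weight_shift[OF tq c, of k] by simp_all
  have R: "integrable lborel (\<lambda>y. R (Complex 0 y))" "(LINT y|lborel. R (Complex 0 y)) = 0"
    unfolding R_def by (rule rational_weight_annihilation[OF P(2) q k])+
  have "(LINT y|lborel. H (Complex c y)) = (LINT y|lborel. H (Complex 0 y) - R (Complex 0 y))"
    using H R by simp
  also have "norm \<dots> \<le> (LINT y|lborel. E * (1 / (1 + y\<^sup>2)))"
  proof (rule Bochner_Integration.integral_norm_bound_integral)
    show "integrable lborel (\<lambda>y. H (Complex 0 y) - R (Complex 0 y))" using H R by simp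
    show "integrable lborel (\<lambda>y::real. E * (1 / (1 + y\<^sup>2)))"
      by (intro integrable_mult_right integrable_inverse_one_plus_square)
    fix y :: real
    define s where "s = Complex 0 y"
    define z where "z = - (q * y\<^sup>2)"
    have z: "z \<le> 0" using q by (simp add: z_def)
    have s2: "s\<^sup>2 = - of_real (y\<^sup>2)" by (simp add: s_def complex_eq_iff power2_eq_square)
    have nz: "1 + s \<noteq> 0" "1 - s \<noteq> 0" by (auto simp: s_def complex_eq_iff)
    have qz: "of_real q * s\<^sup>2 = of_real z" by (simp add: s2 z_def)
    have "of_real q - of_real z = of_real q * (1 - s\<^sup>2)" unfolding qz[symmetric] by (simp add: algebra_simps)
    also have "1 - s\<^sup>2 = (1 - s) * (1 + s)" by (simp add: algebra_simps power2_eq_square)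
    finally have den: "of_real q - of_real z = of_real q * ((1 - s) * (1 + s))" .
    have "R s = r (of_real z) * ((1 - s) ^ k / (1 + s) ^ (k + 2))"
    proof -
      have "(1 - s) ^ k = (1 - s) ^ (k - m) * (1 - s) ^ m" using k by (simp flip: power_add)
      moreover have "(1 + s) ^ (k + 2 + m) = (1 + s) ^ (k + 2) * (1 + s) ^ m" by (simp add: power_add)
      ultimately show ?thesis
        unfolding R_def P(1) den qz power_mult_distrib using nz q by simp
    qed
    moreover have "H s = exp (of_real (t * z)) * ((1 - s) ^ k / (1 + s) ^ (k + 2))"
      unfolding H_def s2 z_def by (simp add: algebra_simps)
    ultimately have "H s - R s = (exp (of_real (t * z)) - r (of_real z)) * ((1 - s) ^ k / (1 + s) ^ (k + 2))"
      by (simp only: left_diff_distrib)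
    also have "norm \<dots> \<le> E * (1 / (norm (1 + s))\<^sup>2)"
      unfolding norm_mult[of "_ - _"] using order_trans[OF norm_ge_zero E[OF z]]
      by (intro mult_mono E z norm_cayley_weight_le) (auto simp: s_def)
    also have "(norm (1 + s))\<^sup>2 = 1 + y\<^sup>2" by (simp add: cmod_power2 s_def)
    finally show "norm (H (Complex 0 y) - R (Complex 0 y)) \<le> E * (1 / (1 + y\<^sup>2))" by (simp add: s_def)
  qed
  also have "\<dots> = pi * E"
    unfolding integral_mult_right_zero integrable_inverse_one_plus_square(2) by (rule mult.commute)
  finally show ?thesis by (simp add: H_def)
qed

section \<open>Laplace's method on the vertical line\<close>
lemma norm_Ln_quadratic_remainder:
  fixes x :: complex
  assumes "norm x \<le> 1/2"
  shows "norm (Ln (1 + x) - x + x\<^sup>2 / 2) \<le> 8 * norm x ^ 3"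
proof -
  define f where "f = (\<lambda>(i::nat) (x::complex). if i = 0 then Ln (1 + x) else if i = 1 then 1 / (1 + x)
     else if i = 2 then - 1 / (1 + x)\<^sup>2 else 2 / (1 + x) ^ 3 :: complex)"
  have ball: "1 + z \<notin> \<real>\<^sub>\<le>\<^sub>0" "norm (1 + z) \<ge> 1/2" "1 + z \<noteq> 0" if "z \<in> cball 0 (1/2)" for z :: complex
  proof -
    have "\<bar>Re z\<bar> \<le> 1/2" using that abs_Re_le_cmod[of z] by simp
    thus "1 + z \<notin> \<real>\<^sub>\<le>\<^sub>0" "1 + z \<noteq> 0" by (auto simp: complex_nonpos_Reals_iff complex_eq_iff)
    show "norm (1 + z) \<ge> 1/2" using that norm_diff_ineq[of 1 z] by simp
  qed
  have rem: "norm (f 0 x - (\<Sum>i\<le>(2::nat). f i 0 * (x - 0) ^ i / fact i)) \<le> 16 * norm (x - 0) ^ Suc 2 / fact 2"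
  proof (rule complex_Taylor[where S = "cball 0 (1/2)"])
    fix i :: nat and z :: complex assume z: "z \<in> cball 0 (1/2)" and i: "i \<le> 2"
    note b = ball[OF z]
    consider "i = 0" | "i = 1" | "i = 2" using i by linarith
    thus "(f i has_field_derivative f (Suc i) z) (at z within cball 0 (1/2))"
    proof cases
      case 1
      thus ?thesis unfolding f_def using b by (auto intro!: derivative_eq_intros simp: inverse_eq_divide)
    next
      case 2
      thus ?thesis unfolding f_def using b
        by (auto intro!: derivative_eq_intros simp: power2_eq_square)
    next
      case 3
      thus ?thesis unfolding f_def using b
        by (auto intro!: derivative_eq_intros simp: power2_eq_square power3_eq_cube divide_simps)
    qed
  next
    fix z :: complex assume z: "z \<in> cball 0 (1/2)"
    have "norm (f (Suc 2) z) = 2 / norm (1 + z) ^ 3" by (simp add: f_def norm_divide norm_power)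
    also have "\<dots> \<le> 2 / (1/2) ^ 3"
      using ball[OF z] by (intro divide_left_mono power_mono mult_pos_pos zero_less_power) auto
    finally show "norm (f (Suc 2) z) \<le> 16" by (simp add: power3_eq_cube)
  qed (use assms in auto)
  moreover have "(\<Sum>i\<le>(2::nat). f i 0 * (x - 0) ^ i / fact i) = x - x\<^sup>2 / 2"
    by (simp add: f_def numeral_2_eq_2)
  ultimately have "norm (f 0 x - (x - x\<^sup>2 / 2)) \<le> 16 * norm (x - 0) ^ Suc 2 / fact 2" by (simp only:)
  moreover have "f 0 x - (x - x\<^sup>2 / 2) = Ln (1 + x) - x + x\<^sup>2 / 2" by (simp add: f_def)
  ultimately have "norm (Ln (1 + x) - x + x\<^sup>2 / 2) \<le> 16 * norm (x - 0) ^ Suc 2 / fact 2" by (simp only:)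
  thus ?thesis by (simp add: eval_nat_numeral)
qed

lemma tendsto_scaled_Ln_remainder:
  fixes x :: "nat \<Rightarrow> complex" and m :: "nat \<Rightarrow> nat"
  assumes "x \<longlonglongrightarrow> 0" and "(\<lambda>n. of_nat (m n) * (x n)\<^sup>2) \<longlonglongrightarrow> L"
  shows "(\<lambda>n. of_nat (m n) * (Ln (1 + x n) - x n)) \<longlonglongrightarrow> - L / 2"
proof -
  define d where "d = (\<lambda>n. of_nat (m n) * (Ln (1 + x n) - x n + (x n)\<^sup>2 / 2))"
  have "d \<longlonglongrightarrow> 0"
  proof (rule Lim_null_comparison)
    have "(\<lambda>n. 8 * norm (of_nat (m n) * (x n)\<^sup>2) * norm (x n)) \<longlonglongrightarrow> 8 * norm L * norm (0 :: complex)"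
      by (intro tendsto_intros assms)
    thus "(\<lambda>n. 8 * norm (of_nat (m n) * (x n)\<^sup>2) * norm (x n)) \<longlonglongrightarrow> 0" by simp
    have "eventually (\<lambda>n. norm (x n) < 1/2) sequentially"
      using assms(1) by (auto simp: tendsto_iff dist_norm elim!: allE[of _ "1/2"])
    thus "eventually (\<lambda>n. norm (d n) \<le> 8 * norm (of_nat (m n) * (x n)\<^sup>2) * norm (x n)) sequentially"
    proof eventually_elim
      case (elim n)
      have "norm (d n) = m n * norm (Ln (1 + x n) - x n + (x n)\<^sup>2 / 2)"
        by (simp add: d_def norm_mult)
      also have "\<dots> \<le> m n * (8 * norm (x n) ^ 3)"
        using elim by (intro mult_left_mono norm_Ln_quadratic_remainder) auto
      finally show ?case by (simp add: norm_mult norm_power power3_eq_cube power2_eq_square mult_ac)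
    qed
  qed
  hence "(\<lambda>n. d n - of_nat (m n) * (x n)\<^sup>2 / 2) \<longlonglongrightarrow> 0 - L / 2"
    by (intro tendsto_intros assms) auto
  thus ?thesis by (simp add: d_def algebra_simps)
qed

text \<open>
  Half of the second derivative of the logarithm of \<open>line_phase p\<close> at the saddle, after elimination of
  higher powers of the saddle by the cubic equation.
\<close>
definition saddle_curvature :: "real \<Rightarrow> complex" where
  "saddle_curvature p = of_real (saddle_alpha p) * (3 - 2 * of_real (saddle_alpha p) * saddle p)"

lemma saddle_cubic:
  assumes "p \<ge> 3/5"
  shows "of_real (saddle_alpha p) * saddle p * (1 - (saddle p)\<^sup>2) = 1"
proof -
  have "of_real (saddle_alpha p) * (saddle p ^ 3 - saddle p) + 1 = 0"
    unfolding cubic_factorization[OF assms] by simp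
  thus ?thesis by (simp add: algebra_simps power2_eq_square power3_eq_cube add_eq_0_iff)
qed

lemma line_phase_ratio_le:
  assumes "p \<ge> 3/5" "p \<le> 4/5"
  shows "norm (line_phase p (Complex p y) / line_phase p (saddle p)) \<le> exp (- (\<bar>y\<bar> - Im (saddle p))\<^sup>2 / 200)"
  using line_modulus_le[OF assms, of y] rate_pos[OF assms(1)]
  unfolding norm_divide saddle_modulus[OF assms(1)] by (simp only: pos_divide_le_eq mult.commute)

lemma tendsto_saddle_alpha:
  assumes "p \<longlonglongrightarrow> P" "P \<ge> 3/5"
  shows "(\<lambda>N. saddle_alpha (p N)) \<longlonglongrightarrow> saddle_alpha P"
  unfolding saddle_alpha_def using assms three_p_sq_gt_1[OF assms(2)] by (intro tendsto_intros) auto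

lemma tendsto_saddle:
  assumes "p \<longlonglongrightarrow> P"
  shows "(\<lambda>N. saddle (p N)) \<longlonglongrightarrow> saddle P"
  unfolding saddle_def Complex_eq by (intro tendsto_intros assms)

lemma saddle_neq: "p \<ge> 3/5 \<Longrightarrow> 1 - saddle p \<noteq> 0" "p \<ge> 3/5 \<Longrightarrow> 1 + saddle p \<noteq> 0"
  using saddle_Im_pos[of p] by (auto simp: complex_eq_iff)

text \<open>
  With \<open>\<eta> = i v / \<surd>m\<close> the ratio of the phases is \<open>exp (\<alpha> (2 \<zeta> \<eta> + \<eta>\<^sup>2)) (1 + x) / (1 + x')\<close> for
  \<open>x = -\<eta> / (1 - \<zeta>)\<close> and \<open>x' = \<eta> / (1 + \<zeta>)\<close>. In \<open>m\<close> times its logarithm the terms of first order in \<open>\<eta>\<close>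
  cancel by the saddle equation, those of second order converge because \<open>m \<eta>\<^sup>2 = -v\<^sup>2\<close>, and the rest is
  \<open>O(m \<bar>\<eta>\<bar>\<^sup>3)\<close>. The saddle may vary with \<open>N\<close>, since \<open>t q\<^sub>N / m\<^sub>N\<close> does.
\<close>
lemma line_phase_power_limit:
  fixes p :: "nat \<Rightarrow> real" and m :: "nat \<Rightarrow> nat" and v :: real
  assumes p: "\<And>N. p N \<ge> 3/5" "p \<longlonglongrightarrow> P" and P: "P \<ge> 3/5"
    and m: "filterlim m at_top sequentially"
  defines "s \<equiv> (\<lambda>N. saddle (p N))"
  shows "(\<lambda>N. (line_phase (p N) (s N + \<i> * of_real (v / sqrt (m N))) / line_phase (p N) (s N)) ^ m N)
     \<longlonglongrightarrow> exp (- saddle_curvature P * of_real (v\<^sup>2))"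
proof -
  define S where "S = saddle P"
  define \<eta> where "\<eta> = (\<lambda>N. \<i> * of_real (v / sqrt (m N)))"
  define a where "a = (\<lambda>N. complex_of_real (saddle_alpha (p N)))"
  define A where "A = complex_of_real (saddle_alpha P)"
  define x where "x = (\<lambda>N. - \<eta> N / (1 - s N))"
  define x' where "x' = (\<lambda>N. \<eta> N / (1 + s N))"
  have s: "s \<longlonglongrightarrow> S" unfolding s_def S_def using p(2) by (rule tendsto_saddle)
  have a: "a \<longlonglongrightarrow> A" unfolding a_def A_def by (intro tendsto_of_real tendsto_saddle_alpha p P)
  have Snz: "1 - S \<noteq> 0" "1 + S \<noteq> 0" using saddle_neq[OF P] by (auto simp: S_def)
  have snz: "1 - s N \<noteq> 0" "1 + s N \<noteq> 0" for N using saddle_neq[OF p(1)] by (auto simp: s_def)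
  have m_real: "filterlim (\<lambda>N. real (m N)) at_top sequentially"
    by (rule filterlim_compose[OF filterlim_real_sequentially m])
  have mpos: "eventually (\<lambda>N. m N > 0) sequentially"
    using m by (auto simp: filterlim_at_top Suc_le_eq elim!: allE[of _ 1])
  have "(\<lambda>N. v / sqrt (m N)) \<longlonglongrightarrow> 0"
    by (rule real_tendsto_divide_at_top[OF tendsto_const filterlim_compose[OF sqrt_at_top m_real]])
  hence "\<eta> \<longlonglongrightarrow> \<i> * of_real 0" unfolding \<eta>_def by (intro tendsto_intros)
  hence \<eta>: "\<eta> \<longlonglongrightarrow> 0" by simp
  have "(\<lambda>N. - \<eta> N / (1 - s N)) \<longlonglongrightarrow> - 0 / (1 - S)" by (intro tendsto_intros \<eta> s Snz)
  hence x0: "x \<longlonglongrightarrow> 0" by (simp add: x_def)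
  have "(\<lambda>N. \<eta> N / (1 + s N)) \<longlonglongrightarrow> 0 / (1 + S)" by (intro tendsto_intros \<eta> s Snz)
  hence x0': "x' \<longlonglongrightarrow> 0" by (simp add: x'_def)
  have m\<eta>: "of_nat (m N) * (\<eta> N)\<^sup>2 = - of_real (v\<^sup>2)" if "m N > 0" for N
  proof -
    have "m N * (v / sqrt (m N))\<^sup>2 = v\<^sup>2" using that by (simp add: power_divide)
    hence "complex_of_real (m N * (v / sqrt (m N))\<^sup>2) = of_real (v\<^sup>2)" by (simp only:)
    moreover have "(\<eta> N)\<^sup>2 = - complex_of_real ((v / sqrt (m N))\<^sup>2)"
      unfolding \<eta>_def power_mult_distrib of_real_power by simp
    ultimately show ?thesis by (simp only: of_real_mult of_real_of_nat_eq mult_minus_right)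
  qed
  have "(\<lambda>N. - of_real (v\<^sup>2) / (1 - s N)\<^sup>2) \<longlonglongrightarrow> - of_real (v\<^sup>2) / (1 - S)\<^sup>2"
    using Snz by (intro tendsto_intros s) auto
  also have "?this \<longleftrightarrow> (\<lambda>N. of_nat (m N) * (x N)\<^sup>2) \<longlonglongrightarrow> - of_real (v\<^sup>2) / (1 - S)\<^sup>2"
    using mpos by (intro filterlim_cong refl) (auto elim!: eventually_mono simp: x_def power_divide m\<eta>)
  finally have mx: "(\<lambda>N. of_nat (m N) * (x N)\<^sup>2) \<longlonglongrightarrow> - of_real (v\<^sup>2) / (1 - S)\<^sup>2" .
  have "(\<lambda>N. - of_real (v\<^sup>2) / (1 + s N)\<^sup>2) \<longlonglongrightarrow> - of_real (v\<^sup>2) / (1 + S)\<^sup>2"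
    using Snz by (intro tendsto_intros s) auto
  also have "?this \<longleftrightarrow> (\<lambda>N. of_nat (m N) * (x' N)\<^sup>2) \<longlonglongrightarrow> - of_real (v\<^sup>2) / (1 + S)\<^sup>2"
    using mpos by (intro filterlim_cong refl) (auto elim!: eventually_mono simp: x'_def power_divide m\<eta>)
  finally have mx': "(\<lambda>N. of_nat (m N) * (x' N)\<^sup>2) \<longlonglongrightarrow> - of_real (v\<^sup>2) / (1 + S)\<^sup>2" .
  define T where "T = (\<lambda>N. - a N * of_real (v\<^sup>2) + of_nat (m N) * (Ln (1 + x N) - x N) - of_nat (m N) * (Ln (1 + x' N) - x' N))"
  have "T \<longlonglongrightarrow> - A * of_real (v\<^sup>2) + - (- of_real (v\<^sup>2) / (1 - S)\<^sup>2) / 2 - - (- of_real (v\<^sup>2) / (1 + S)\<^sup>2) / 2"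
    unfolding T_def by (intro tendsto_intros a tendsto_scaled_Ln_remainder x0 x0' mx mx')
  also have "- A * of_real (v\<^sup>2) + - (- of_real (v\<^sup>2) / (1 - S)\<^sup>2) / 2 - - (- of_real (v\<^sup>2) / (1 + S)\<^sup>2) / 2
     = - saddle_curvature P * of_real (v\<^sup>2)"
  proof -
    have cub: "A * S * (1 - S\<^sup>2) = 1" using saddle_cubic[OF P] by (simp add: A_def S_def)
    have fac: "1 - S\<^sup>2 = (1 - S) * (1 + S)" by (simp add: algebra_simps power2_eq_square)
    have "1 / (1 - S)\<^sup>2 - 1 / (1 + S)\<^sup>2 = 4 * S / (1 - S\<^sup>2)\<^sup>2"
      unfolding fac power_mult_distrib using Snz by (simp add: divide_simps) (simp add: power2_eq_square algebra_simps)
    also have "1 / (1 - S\<^sup>2) = A * S" using cub Snz fac by (simp add: divide_simps)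
    hence "4 * S / (1 - S\<^sup>2)\<^sup>2 = 4 * S * (A * S)\<^sup>2" by (metis power_one_over mult.right_neutral times_divide_eq_right)
    also have "\<dots> = 4 * A * (A * S - 1)"
      using arg_cong[OF cub, of "\<lambda>x. - 4 * A * x"] by (simp add: power2_eq_square algebra_simps)
    finally have d: "1 / (1 - S)\<^sup>2 = 1 / (1 + S)\<^sup>2 + 4 * A * (A * S - 1)" by (simp add: algebra_simps)
    have "- A * of_real (v\<^sup>2) + - (- of_real (v\<^sup>2) / (1 - S)\<^sup>2) / 2 - - (- of_real (v\<^sup>2) / (1 + S)\<^sup>2) / 2
       = of_real (v\<^sup>2) * (- A + (1 / (1 - S)\<^sup>2 - 1 / (1 + S)\<^sup>2) / 2)"
      by (simp add: algebra_simps)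
    also have "\<dots> = - saddle_curvature P * of_real (v\<^sup>2)"
    proof -
      have half: "(1 / (1 - S)\<^sup>2 - 1 / (1 + S)\<^sup>2) / 2 = 2 * A * (A * S - 1)" using d by simp
      show ?thesis unfolding half by (simp add: saddle_curvature_def A_def[symmetric] S_def[symmetric] algebra_simps)
    qed
    finally show ?thesis .
  qed
  finally have T: "(\<lambda>N. exp (T N)) \<longlonglongrightarrow> exp (- saddle_curvature P * of_real (v\<^sup>2))"
    by (intro tendsto_exp)
  \<comment> \<open>Moduli below \<open>1\<close> keep \<open>1 + x N\<close> and \<open>1 + x' N\<close> nonzero, so that \<open>exp\<close> inverts \<open>Ln\<close> there.\<close>
  have ev: "eventually (\<lambda>N. norm (x N) < 1 \<and> norm (x' N) < 1 \<and> m N > 0) sequentially"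
    using x0 x0' mpos by (auto simp: tendsto_iff dist_norm eventually_conj_iff)
  have "eventually (\<lambda>N. exp (T N) = (line_phase (p N) (s N + \<eta> N) / line_phase (p N) (s N)) ^ m N) sequentially"
    using ev
  proof eventually_elim
    case (elim N)
    define L where "L = a N * (2 * s N * \<eta> N + (\<eta> N)\<^sup>2) + Ln (1 + x N) - Ln (1 + x' N)"
    have xnz: "1 + x N \<noteq> 0" "1 + x' N \<noteq> 0" 
      using elim by (metis add_eq_0_iff norm_minus_cancel norm_one less_irrefl)+
    have cub: "a N * s N * (1 - (s N)\<^sup>2) = 1" using saddle_cubic[OF p(1)] by (simp add: a_def s_def)
    have fac: "1 - (s N)\<^sup>2 = (1 - s N) * (1 + s N)" by (simp add: algebra_simps power2_eq_square)
    have lin: "a N * (2 * s N * \<eta> N) = x' N - x N"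
    proof -
      have "x' N - x N = 2 * \<eta> N / ((1 - s N) * (1 + s N))"
        unfolding x_def x'_def using snz[of N] by (simp add: divide_simps) (simp add: algebra_simps)
      also have "\<dots> = 2 * \<eta> N * (1 / (1 - (s N)\<^sup>2))" unfolding fac by simp
      also have "1 / (1 - (s N)\<^sup>2) = a N * s N" using cub snz[of N] fac by (simp add: divide_simps)
      finally show ?thesis by (simp add: mult_ac)
    qed
    have "exp L = exp (a N * (2 * s N * \<eta> N + (\<eta> N)\<^sup>2)) * ((1 + x N) / (1 + x' N))"
      using xnz by (simp add: L_def exp_add exp_diff)
    also have "(1 + x N) / (1 + x' N) = ((1 - (s N + \<eta> N)) / (1 + (s N + \<eta> N))) / ((1 - s N) / (1 + s N))"
    proof -
      have "1 + x N = (1 - (s N + \<eta> N)) / (1 - s N)" "1 + x' N = (1 + (s N + \<eta> N)) / (1 + s N)"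
        unfolding x_def x'_def using snz[of N] by (simp_all add: field_simps)
      thus ?thesis by simp
    qed
    also have "exp (a N * (2 * s N * \<eta> N + (\<eta> N)\<^sup>2)) = exp (a N * (s N + \<eta> N)\<^sup>2) / exp (a N * (s N)\<^sup>2)"
      by (simp add: power2_sum algebra_simps flip: exp_diff)
    finally have "exp L = line_phase (p N) (s N + \<eta> N) / line_phase (p N) (s N)"
      by (simp add: line_phase_def a_def mult_ac)
    hence "(line_phase (p N) (s N + \<eta> N) / line_phase (p N) (s N)) ^ m N = exp (of_nat (m N) * L)"
      by (simp add: exp_of_nat_mult)
    also have "of_nat (m N) * L = a N * (of_nat (m N) * (\<eta> N)\<^sup>2) + of_nat (m N) * (Ln (1 + x N) - x N) - of_nat (m N) * (Ln (1 + x' N) - x' N)"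
      unfolding L_def distrib_left[of "a N"] lin by (simp add: algebra_simps)
    also have "\<dots> = T N" using elim m\<eta>[of N] by (simp add: T_def)
    finally show ?case by simp
  qed
  from Lim_transform_eventually[OF T this] show ?thesis by (simp add: \<eta>_def)
qed

lemma norm_gaussian_complex: "norm (exp (- l * of_real (v\<^sup>2))) = exp (- Re l * v\<^sup>2)"
  by (simp add: norm_exp_eq_Re)

lemma integrable_complex_gaussian:
  assumes "Re l > 0"
  shows "integrable lborel (\<lambda>v. exp (- l * of_real (v\<^sup>2)))"
proof (rule integrable_gaussian_dominated[OF assms])
  show "continuous_on UNIV (\<lambda>v. exp (- l * of_real (v\<^sup>2)))" by (intro continuous_intros)
  show "norm (exp (- l * of_real (v\<^sup>2))) \<le> 1 * exp (- Re l * v\<^sup>2)" for v :: real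
    unfolding norm_gaussian_complex by simp
qed

text \<open>
  The lower bound needs the constant of Laplace's method to be nonzero. Near the balanced point
  the argument of \<open>l\<close> is small enough for the bound \<open>cos x \<ge> 1 - x\<^sup>2 / 2\<close>, together with the fourth moment
  of the normal distribution, to show it.
\<close>
lemma complex_gaussian_integral_Re_pos:
  assumes l: "Re l > 0" and angle: "3 * (Im l)\<^sup>2 < 8 * (Re l)\<^sup>2"
  shows "Re (LINT v|lborel. exp (- l * of_real (v\<^sup>2))) > 0"
proof -
  define \<mu> where "\<mu> = Re l"
  define \<sigma> where "\<sigma> = 1 / sqrt (2 * \<mu>)"
  define c where "c = sqrt (2 * pi * \<sigma>\<^sup>2)"
  have \<sigma>: "\<sigma> > 0" "\<sigma>\<^sup>2 = 1 / (2 * \<mu>)" using l by (auto simp: \<sigma>_def \<mu>_def power_divide)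
  have c: "c > 0" using \<sigma>(1) by (simp add: c_def)
  have dens: "exp (- \<mu> * v\<^sup>2) = c * normal_density 0 \<sigma> v" for v
  proof -
    have "normal_density 0 \<sigma> v = 1 / c * exp (- \<mu> * v\<^sup>2)"
      unfolding normal_density_def c_def[symmetric] using l by (simp add: \<sigma>(2) \<mu>_def mult.commute)
    thus ?thesis using c by simp
  qed
  have m0: "has_bochner_integral lborel (normal_density 0 \<sigma>) 1"
    using normal_moment_even[OF \<sigma>(1), of 0 0] by simp
  have m4: "has_bochner_integral lborel (\<lambda>v. normal_density 0 \<sigma> v * v ^ 4) (3 / (4 * \<mu>\<^sup>2))"
  proof -
    have "fact (2 * 2) / ((2 / \<sigma>\<^sup>2) ^ 2 * fact 2) = 3 / (4 * \<mu>\<^sup>2)"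
      using l unfolding \<sigma>(2) by (simp add: fact_numeral power2_eq_square)
    thus ?thesis using normal_moment_even[OF \<sigma>(1), of 0 2] by simp
  qed
  have "has_bochner_integral lborel (\<lambda>v. c * (normal_density 0 \<sigma> v - (Im l)\<^sup>2 / 2 * (normal_density 0 \<sigma> v * v ^ 4)))
      (c * (1 - (Im l)\<^sup>2 / 2 * (3 / (4 * \<mu>\<^sup>2))))"
    by (intro has_bochner_integral_mult_right has_bochner_integral_diff m0 m4)
  note low = this[unfolded has_bochner_integral_iff]
  have "0 < c * (1 - (Im l)\<^sup>2 / 2 * (3 / (4 * \<mu>\<^sup>2)))"
    using c angle l by (intro mult_pos_pos) (auto simp: \<mu>_def field_simps)
  also have "\<dots> = (LINT v|lborel. c * (normal_density 0 \<sigma> v - (Im l)\<^sup>2 / 2 * (normal_density 0 \<sigma> v * v ^ 4)))"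
    using conjunct2[OF low] by (simp only:)
  also have "\<dots> \<le> (LINT v|lborel. Re (exp (- l * of_real (v\<^sup>2))))"
  proof (rule integral_mono)
    show "integrable lborel (\<lambda>v. Re (exp (- l * of_real (v\<^sup>2))))"
      using integrable_complex_gaussian[OF l] by (rule integrable_Re)
    fix v :: real
    have cos: "cos x \<ge> 1 - x\<^sup>2 / 2" for x :: real
    proof -
      have "cos x = 1 - 2 * (sin (x / 2))\<^sup>2"
        using cos_double_sin[of "x / 2"] by simp
      moreover have "(sin (x / 2))\<^sup>2 \<le> (x / 2)\<^sup>2"
        using abs_sin_x_le_abs_x[of "x / 2"] by (simp only: abs_le_square_iff)
      ultimately show ?thesis by (simp add: power_divide)
    qed
    have "c * (normal_density 0 \<sigma> v - (Im l)\<^sup>2 / 2 * (normal_density 0 \<sigma> v * v ^ 4)) = exp (- \<mu> * v\<^sup>2) * (1 - (Im l * v\<^sup>2)\<^sup>2 / 2)"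
      unfolding dens by (simp add: algebra_simps power_mult_distrib)
    also have "\<dots> \<le> exp (- \<mu> * v\<^sup>2) * cos (Im l * v\<^sup>2)"
      by (intro mult_left_mono cos) auto
    also have "\<dots> = Re (exp (- l * of_real (v\<^sup>2)))"
      by (simp add: Re_exp \<mu>_def)
    finally show "c * (normal_density 0 \<sigma> v - (Im l)\<^sup>2 / 2 * (normal_density 0 \<sigma> v * v ^ 4)) \<le> Re (exp (- l * of_real (v\<^sup>2)))" .
  qed (use low in simp)
  also have "\<dots> = Re (LINT v|lborel. exp (- l * of_real (v\<^sup>2)))"
    using integrable_complex_gaussian[OF l] by simp
  finally show ?thesis .
qed

text \<open>
  With \<open>r = Im \<zeta>\<^sub>\<alpha>\<close> the quotient of the imaginary by the real part of the curvature has modulus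
  \<open>1 / (4 p r)\<close>, and \<open>3 < 128 p\<^sup>2 r\<^sup>2\<close> on the interval.
\<close>
lemma saddle_curvature_sector:
  assumes p: "p \<ge> 3/5" "p \<le> 4/5"
  shows "Re (saddle_curvature p) > 0" "3 * (Im (saddle_curvature p))\<^sup>2 < 8 * (Re (saddle_curvature p))\<^sup>2"
proof -
  define a where "a = saddle_alpha p"
  define r where "r = Im (saddle p)"
  define t where "t = 4 * p\<^sup>2 - 1"
  have r: "r\<^sup>2 = 3 * p\<^sup>2 - 1" "r > 0" using saddle_Im_sq saddle_Im_pos p by (auto simp: r_def)
  have a: "a > 0" using saddle_alpha_pos p by (simp add: a_def)
  have t: "t > 0" using three_p_sq_gt_1[OF p(1)] by (simp add: t_def)
  have p2: "p\<^sup>2 \<ge> 9/25" using mult_mono[of "3/5" p "3/5" p] p by (simp add: power2_eq_square)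
  have at: "2 * a * p * t = 1" using t p by (simp add: a_def saddle_alpha_def t_def field_simps)
  have re: "Re (saddle_curvature p) = a * (3 - 2 * a * p)"
    by (simp add: saddle_curvature_def a_def saddle_Re)
  have im: "Im (saddle_curvature p) = - (2 * a\<^sup>2 * r)"
    by (simp add: saddle_curvature_def a_def r_def power2_eq_square)
  have "2 * a * p = 1 / t" using at t by (simp add: field_simps)
  hence "3 - 2 * a * p = (3 * t - 1) / t" using t by (simp add: field_simps)
  also have "3 * t - 1 = 4 * r\<^sup>2" by (simp add: t_def r)
  finally have x: "3 - 2 * a * p = 4 * r\<^sup>2 / t" .
  show "Re (saddle_curvature p) > 0" unfolding re x using a r(2) t by (intro mult_pos_pos divide_pos_pos zero_less_power) auto
  have "3 < 128 * (p\<^sup>2 * r\<^sup>2)"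
  proof -
    have "(9/25) * (2/25) \<le> p\<^sup>2 * r\<^sup>2" unfolding r using p2 by (intro mult_mono) auto
    thus ?thesis by simp
  qed
  have "3 * (Im (saddle_curvature p))\<^sup>2 * (p\<^sup>2 * t\<^sup>2) = 3 * a\<^sup>2 * r\<^sup>2 * (2 * a * p * t)\<^sup>2"
    unfolding im by (simp add: power2_eq_square)
  also have "\<dots> = 3 * (a\<^sup>2 * r\<^sup>2)" unfolding at by simp
  also have "\<dots> < 128 * (p\<^sup>2 * r\<^sup>2) * (a\<^sup>2 * r\<^sup>2)"
    using \<open>3 < _\<close> a r(2) by (intro mult_strict_right_mono mult_pos_pos zero_less_power) auto
  also have "\<dots> = 8 * (Re (saddle_curvature p))\<^sup>2 * (p\<^sup>2 * t\<^sup>2)"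
    unfolding re x using t by (simp add: power2_eq_square field_simps)
  finally show "3 * (Im (saddle_curvature p))\<^sup>2 < 8 * (Re (saddle_curvature p))\<^sup>2"
    by (rule mult_right_less_imp_less) auto
qed

text \<open>
  Substitute \<open>y = r + v / \<surd>m\<close> and use dominated convergence; \<open>line_phase_ratio_le\<close> provides the
  dominating function \<open>exp (-v\<^sup>2 / 200)\<close>. The integral is restricted to \<open>y > 0\<close> so that only one of the two
  conjugate saddles contributes.
\<close>
lemma laplace_half_line:
  fixes p :: "nat \<Rightarrow> real" and m :: "nat \<Rightarrow> nat" and g :: "complex \<Rightarrow> complex"
  assumes p: "\<And>N. p N \<ge> 3/5" "\<And>N. p N \<le> 4/5" "p \<longlonglongrightarrow> P"
    and m: "filterlim m at_top sequentially"
    and g: "continuous_on {z. Re z > 0} g" "\<And>z. Re z > 0 \<Longrightarrow> norm (g z) \<le> 1"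
  shows "(\<lambda>N. of_real (sqrt (m N)) * (LINT y|lborel. indicator {0<..} y *\<^sub>R
      ((line_phase (p N) (Complex (p N) y) / line_phase (p N) (saddle (p N))) ^ m N * g (Complex (p N) y))))
    \<longlonglongrightarrow> g (saddle P) * (LINT v|lborel. exp (- saddle_curvature P * of_real (v\<^sup>2)))"
proof -
  have P: "P \<ge> 3/5" using p(1,3) by (intro LIMSEQ_le_const[OF p(3)]) auto
  define r where "r = (\<lambda>N. Im (saddle (p N)))"
  define f where "f = (\<lambda>N y. indicator {0<..} y *\<^sub>R
      ((line_phase (p N) (Complex (p N) y) / line_phase (p N) (saddle (p N))) ^ m N * g (Complex (p N) y)))"
  define s where "s = (\<lambda>N v. if m N > 0 then f N (r N + 1 / sqrt (m N) * v) else 0)"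
  have m_real: "filterlim (\<lambda>N. real (m N)) at_top sequentially"
    by (rule filterlim_compose[OF filterlim_real_sequentially m])
  have mpos: "eventually (\<lambda>N. m N > 0) sequentially"
    using m by (auto simp: filterlim_at_top Suc_le_eq elim!: allE[of _ 1])
  have r: "r \<longlonglongrightarrow> Im (saddle P)" unfolding r_def by (intro tendsto_intros tendsto_saddle p)
  have nz: "1 + Complex (p N) y \<noteq> 0" for N y using p(1)[of N] by (auto simp: complex_eq_iff)
  have meas: "f N \<in> borel_measurable borel" for N
  proof -
    have "continuous_on UNIV (\<lambda>y. g (Complex (p N) y))"
      using p(1)[of N] by (intro continuous_on_compose2[OF g(1)] continuous_intros) auto
    moreover have "continuous_on UNIV (\<lambda>y. line_phase (p N) (Complex (p N) y))"
      unfolding line_phase_def using nz by (intro continuous_intros) auto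
    ultimately have "(\<lambda>y. (line_phase (p N) (Complex (p N) y) / line_phase (p N) (saddle (p N))) ^ m N * g (Complex (p N) y)) \<in> borel_measurable borel"
      unfolding divide_inverse by (intro borel_measurable_continuous_onI continuous_intros)
    thus ?thesis unfolding f_def by measurable
  qed
  have "(\<lambda>N. LINT v|lborel. s N v) \<longlonglongrightarrow> (LINT v|lborel. exp (- saddle_curvature P * of_real (v\<^sup>2)) * g (saddle P))"
  proof (rule integral_dominated_convergence[where w = "\<lambda>v. exp (- (1/200) * v\<^sup>2)"])
    show "(\<lambda>v. exp (- saddle_curvature P * complex_of_real (v\<^sup>2)) * g (saddle P)) \<in> borel_measurable lborel"
      by measurable
    show "s N \<in> borel_measurable lborel" for N
      unfolding s_def using meas[of N] by measurable
    show "integrable lborel (\<lambda>v::real. exp (- (1/200) * v\<^sup>2))"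
      using integrable_gaussian[of "1/200" 0] by simp
    show "AE v in lborel. norm (s N v) \<le> exp (- (1/200) * v\<^sup>2)" for N
    proof (rule AE_I2)
      fix v :: real
      define y where "y = r N + 1 / sqrt (m N) * v"
      show "norm (s N v) \<le> exp (- (1/200) * v\<^sup>2)"
      proof (cases "m N > 0 \<and> y > 0")
        case True
        have "norm (s N v) = norm (line_phase (p N) (Complex (p N) y) / line_phase (p N) (saddle (p N))) ^ m N * norm (g (Complex (p N) y))"
          using True by (simp add: s_def f_def y_def norm_mult norm_power)
        also have "\<dots> \<le> exp (- (\<bar>y\<bar> - r N)\<^sup>2 / 200) ^ m N * 1"
          unfolding r_def using p(1,2)[of N] by (intro mult_mono power_mono line_phase_ratio_le g) auto
        also have "\<dots> = exp (- (1/200) * v\<^sup>2)"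
        proof -
          have "m N * (1 / sqrt (m N) * v)\<^sup>2 = v\<^sup>2"
            using True by (simp add: power_mult_distrib power_divide)
          moreover have "\<bar>y\<bar> - r N = 1 / sqrt (m N) * v" using True by (simp add: y_def)
          ultimately have "of_nat (m N) * (- (\<bar>y\<bar> - r N)\<^sup>2 / 200) = - (1/200) * v\<^sup>2"
            by simp
          thus ?thesis unfolding mult_1_right exp_of_nat_mult[symmetric] by (rule arg_cong)
        qed
        finally show ?thesis .
      qed (auto simp: s_def f_def y_def)
    qed
    show "AE v in lborel. (\<lambda>N. s N v) \<longlonglongrightarrow> exp (- saddle_curvature P * of_real (v\<^sup>2)) * g (saddle P)"
    proof (rule AE_I2)
      fix v :: real
      define h where "h = (\<lambda>N. v / sqrt (m N))"
      have h: "h \<longlonglongrightarrow> 0" unfolding h_def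
        by (rule real_tendsto_divide_at_top[OF tendsto_const filterlim_compose[OF sqrt_at_top m_real]])
      have Cx: "Complex (p N) (r N + h N) = saddle (p N) + \<i> * of_real (h N)" for N
        by (simp add: complex_eq_iff saddle_Re r_def)
      have "(\<lambda>N. saddle (p N) + \<i> * of_real (h N)) \<longlonglongrightarrow> saddle P + \<i> * of_real 0"
        by (intro tendsto_intros tendsto_saddle p h)
      hence "(\<lambda>N. saddle (p N) + \<i> * of_real (h N)) \<longlonglongrightarrow> saddle P" by simp
      moreover have "isCont g (saddle P)"
      proof -
        have "open {z. Re z > 0}" by (rule open_halfspace_Re_gt)
        thus ?thesis using g(1) P by (auto simp: continuous_on_eq_continuous_at saddle_Re)
      qed
      ultimately have "(\<lambda>N. g (saddle (p N) + \<i> * of_real (h N))) \<longlonglongrightarrow> g (saddle P)"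
        by (rule isCont_tendsto_compose[rotated])
      hence lim: "(\<lambda>N. (line_phase (p N) (Complex (p N) (r N + h N)) / line_phase (p N) (saddle (p N))) ^ m N * g (Complex (p N) (r N + h N)))
         \<longlonglongrightarrow> exp (- saddle_curvature P * of_real (v\<^sup>2)) * g (saddle P)"
        unfolding Cx unfolding h_def by (intro tendsto_mult line_phase_power_limit p P m)
      have "(\<lambda>N. r N + h N) \<longlonglongrightarrow> Im (saddle P) + 0" by (intro tendsto_intros r h)
      hence "eventually (\<lambda>N. r N + h N > 0) sequentially"
        using saddle_Im_pos[OF P] by (intro order_tendstoD(1)) auto
      with mpos have "eventually (\<lambda>N. (line_phase (p N) (Complex (p N) (r N + h N)) / line_phase (p N) (saddle (p N))) ^ m N * g (Complex (p N) (r N + h N)) = s N v) sequentially"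
        by eventually_elim (simp add: s_def f_def h_def)
      from Lim_transform_eventually[OF lim this]
      show "(\<lambda>N. s N v) \<longlonglongrightarrow> exp (- saddle_curvature P * of_real (v\<^sup>2)) * g (saddle P)" .
    qed
  qed
  also have "(LINT v|lborel. exp (- saddle_curvature P * of_real (v\<^sup>2)) * g (saddle P)) = g (saddle P) * (LINT v|lborel. exp (- saddle_curvature P * of_real (v\<^sup>2)))"
    by simp
  finally have lim: "(\<lambda>N. LINT v|lborel. s N v) \<longlonglongrightarrow> g (saddle P) * (LINT v|lborel. exp (- saddle_curvature P * of_real (v\<^sup>2)))" .
  have "eventually (\<lambda>N. (LINT v|lborel. s N v) = of_real (sqrt (m N)) * (LINT y|lborel. f N y)) sequentially"
    using mpos
  proof eventually_elim
    case (elim N)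
    have "(LINT y|lborel. f N y) = \<bar>1 / sqrt (m N)\<bar> *\<^sub>R (LINT v|lborel. f N (r N + 1 / sqrt (m N) * v))"
      by (rule lborel_integral_real_affine) (use elim in auto)
    also have "(LINT v|lborel. f N (r N + 1 / sqrt (m N) * v)) = (LINT v|lborel. s N v)"
      using elim by (simp add: s_def)
    finally show ?case using elim by (simp add: scaleR_conv_of_real)
  qed
  from Lim_transform_eventually[OF lim this] show ?thesis by (simp add: f_def)
qed

section \<open>Lower bound\<close>

text \<open>
  The conjugate saddle contributes the conjugate of the upper one, which is where the oscillating real
  part in the lower bound comes from.
\<close>
lemma integral_conjugate_symmetric:
  fixes f :: "real \<Rightarrow> complex"
  assumes int: "integrable lborel f" and sym: "\<And>y. f (- y) = cnj (f y)"
  shows "(LINT y|lborel. f y) = of_real (2 * Re (LINT y|lborel. indicator {0<..} y *\<^sub>R f y))"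
proof -
  define h where "h = (\<lambda>y. indicator {0<..} y *\<^sub>R f y)"
  have h: "integrable lborel h" unfolding h_def by (intro integrable_mult_indicator int) auto
  have h': "integrable lborel (\<lambda>y. h (- y))"
    using lborel_integrable_real_affine[OF h, of "-1" 0] by simp
  have "(LINT y|lborel. f y) = (LINT y|lborel. h y + cnj (h (- y)))"
  proof (rule integral_cong_AE)
    have "AE y in lborel. y \<noteq> (0 :: real)" by (rule AE_lborel_singleton)
    thus "AE y in lborel. f y = h y + cnj (h (- y))"
      by eventually_elim (auto simp: h_def sym indicator_def)
    have "integrable lborel (\<lambda>y. h y + cnj (h (- y)))" using h h' by simp
    thus "(\<lambda>y. h y + cnj (h (- y))) \<in> borel_measurable lborel" by (rule borel_measurable_integrable)
  qed (use int in auto)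
  also have "\<dots> = (LINT y|lborel. h y) + cnj (LINT y|lborel. h (- y))"
    using h h' by simp
  also have "(LINT y|lborel. h (- y)) = (LINT y|lborel. h y)"
    using lborel_integral_real_affine[of "-1" h 0] by simp
  finally show ?thesis by (simp add: h_def complex_add_cnj)
qed

text \<open>
  Two complex numbers that are not real multiples of each other cannot both be turned into nearly
  imaginary numbers by one and the same rotation \<open>u\<close>.
\<close>
lemma abs_Im_cnj_mult_le:
  "\<bar>Im (cnj k1 * k2)\<bar> \<le> max \<bar>Re (u * k1)\<bar> \<bar>Re (u * k2)\<bar> * (norm k1 + norm k2)" if "norm u = 1"
proof -
  define a b where "a = u * k1" "b = u * k2"
  have n: "norm a = norm k1" "norm b = norm k2" using that by (auto simp: a_b_def norm_mult)
  have "cnj a * b = (u * cnj u) * (cnj k1 * k2)" by (simp add: a_b_def mult_ac)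
  also have "u * cnj u = 1" using complex_norm_square[of u] that by simp
  finally have "cnj k1 * k2 = cnj a * b" by simp
  hence "\<bar>Im (cnj k1 * k2)\<bar> = \<bar>Re a * Im b - Im a * Re b\<bar>" by (simp only:) simp
  also have "\<dots> \<le> \<bar>Re a\<bar> * \<bar>Im b\<bar> + \<bar>Im a\<bar> * \<bar>Re b\<bar>"
    by (metis abs_mult abs_triangle_ineq4)
  also have "\<dots> \<le> max \<bar>Re a\<bar> \<bar>Re b\<bar> * norm b + norm a * max \<bar>Re a\<bar> \<bar>Re b\<bar>"
    by (intro add_mono mult_mono abs_Im_le_cmod) auto
  finally show ?thesis using n by (simp add: a_b_def algebra_simps)
qed

lemma rat_error_ge_half_line:
  assumes q: "q > 0" and t: "t > 0" and p: "p \<ge> 3/5" and tq: "t * q = m * saddle_alpha p" and j: "m \<le> k"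
  shows "2 / pi * \<bar>Re (LINT y|lborel. indicator {0<..} y *\<^sub>R
      (line_phase p (Complex p y) ^ m * ((1 - Complex p y) ^ (k - m) / (1 + Complex p y) ^ (k - m + 2))))\<bar> \<le> rat_error m t q"
proof (rule le_rat_error[OF q t])
  fix r E assume rE: "r \<in> rat_class m q" "\<And>z. z \<le> 0 \<Longrightarrow> cmod (exp (of_real (t * z)) - r (of_real z)) \<le> E"
  define H where "H = (\<lambda>z::complex. exp (of_real (t * q) * z\<^sup>2) * ((1 - z) ^ k / (1 + z) ^ (k + 2)))"
  have nz: "1 + Complex p y \<noteq> 0" for y using p by (auto simp: complex_eq_iff)
  have H: "H (Complex p y) = line_phase p (Complex p y) ^ m * ((1 - Complex p y) ^ (k - m) / (1 + Complex p y) ^ (k - m + 2))" for y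
  proof -
    define s where "s = Complex p y"
    have "(1 - s) ^ k = (1 - s) ^ (k - m) * (1 - s) ^ m" "(1 + s) ^ (k + 2) = (1 + s) ^ (k - m + 2) * (1 + s) ^ m"
      using j by (simp_all flip: power_add)
    thus ?thesis
      unfolding H_def line_phase_def tq s_def[symmetric] power_mult_distrib power_divide exp_of_nat_mult[symmetric]
      by (simp add: mult_ac)
  qed
  have tq0: "t * q > 0" using t q by simp
  have int: "integrable lborel (\<lambda>y. H (Complex p y))"
    unfolding H_def using gaussian_weight_shift(1)[OF tq0, of p k] p by simp
  have sym: "H (Complex p (- y)) = cnj (H (Complex p y))" for y
  proof -
    have "Complex p (- y) = cnj (Complex p y)" by (simp add: complex_eq_iff)
    thus ?thesis by (simp add: H_def exp_cnj)
  qed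
  have "norm (LINT y|lborel. H (Complex p y)) \<le> pi * E"
    unfolding H_def using p by (intro contour_functional_le_error[OF q t j _ rE]) auto
  also have "(LINT y|lborel. H (Complex p y)) = of_real (2 * Re (LINT y|lborel. indicator {0<..} y *\<^sub>R H (Complex p y)))"
    by (rule integral_conjugate_symmetric[OF int sym])
  finally have "2 * \<bar>Re (LINT y|lborel. indicator {0<..} y *\<^sub>R H (Complex p y))\<bar> \<le> pi * E"
    unfolding norm_of_real by (simp add: abs_mult)
  thus "2 / pi * \<bar>Re (LINT y|lborel. indicator {0<..} y *\<^sub>R
      (line_phase p (Complex p y) ^ m * ((1 - Complex p y) ^ (k - m) / (1 + Complex p y) ^ (k - m + 2))))\<bar> \<le> E"
    unfolding H by (simp add: field_simps)
qed

text \<open>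
  The two functionals are those for \<open>k = m\<close> and \<open>k = m + 1\<close>. Their half-line integrals, divided by
  \<open>line_phase p \<zeta>\<^sub>\<alpha>\<close> to the power \<open>m\<close> and multiplied by \<open>\<surd>m\<close>, converge to numbers \<open>g 0 S * K\<close> and
  \<open>g 1 S * K\<close> whose quotient \<open>(1 - S) / (1 + S)\<close> is not real, so whatever the unit factor \<open>u\<close> of
  the power may be, \<open>abs_Im_cnj_mult_le\<close> bounds one of the two real parts from below.
\<close>
lemma rat_error_lower:
  fixes p q :: "nat \<Rightarrow> real" and m :: "nat \<Rightarrow> nat" and t :: real
  assumes p: "\<And>N. p N \<ge> 3/5" "\<And>N. p N \<le> 4/5" "p \<longlonglongrightarrow> P"
    and m: "filterlim m at_top sequentially" and t: "t > 0"
    and q: "eventually (\<lambda>N. q N > 0 \<and> t * q N = m N * saddle_alpha (p N)) sequentially"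
  obtains \<kappa> where "\<kappa> > 0"
    "eventually (\<lambda>N. rat_error (m N) t (q N) \<ge> \<kappa> * (rate (p N) ^ m N / sqrt (m N))) sequentially"
proof -
  have P: "P \<ge> 3/5" "P \<le> 4/5"
    using LIMSEQ_le_const[OF p(3)] LIMSEQ_le_const2[OF p(3)] p(1,2) by blast+
  define S where "S = saddle P"
  define K where "K = (LINT v|lborel. exp (- saddle_curvature P * of_real (v\<^sup>2)))"
  have "Re K > 0" unfolding K_def by (intro complex_gaussian_integral_Re_pos saddle_curvature_sector P)
  hence K: "K \<noteq> 0" by auto
  define g where "g = (\<lambda>(j::nat) z :: complex. (1 - z) ^ j / (1 + z) ^ (j + 2))"
  define B where "B = (\<lambda>j N. of_real (sqrt (m N)) * (LINT y|lborel. indicator {0<..} y *\<^sub>R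
      ((line_phase (p N) (Complex (p N) y) / line_phase (p N) (saddle (p N))) ^ m N * g j (Complex (p N) y))))"
  have B: "B j \<longlonglongrightarrow> g j S * K" for j
    unfolding B_def S_def K_def
  proof (rule laplace_half_line[OF p m])
    have nz: "1 + z \<noteq> 0" if "Re z > 0" for z :: complex using that by (auto simp: complex_eq_iff)
    thus "continuous_on {z. Re z > 0} (g j)"
      unfolding g_def by (intro continuous_intros) auto
    fix z :: complex assume z: "Re z > 0"
    have "norm (g j z) \<le> 1 / (norm (1 + z))\<^sup>2" unfolding g_def using z by (intro norm_cayley_weight_le) auto
    also have "\<dots> \<le> 1"
    proof -
      have "1 + (Im z)\<^sup>2 \<le> (norm (1 + z))\<^sup>2" using norm_one_plus_ge(2)[of z] z by simp
      hence "1 \<le> (norm (1 + z))\<^sup>2" by (rule order_trans[rotated]) simp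
      thus ?thesis by (simp add: divide_le_eq_1)
    qed
    finally show "norm (g j z) \<le> 1" .
  qed
  \<comment> \<open>The lower bound that \<open>abs_Im_cnj_mult_le\<close> gives for the larger real part, and its limit.\<close>
  define c where "c = (\<lambda>N. \<bar>Im (cnj (B 0 N) * B 1 N)\<bar> / (norm (B 0 N) + norm (B 1 N)))"
  define c0 where "c0 = \<bar>Im (cnj (g 0 S * K) * (g 1 S * K))\<bar> / (norm (g 0 S * K) + norm (g 1 S * K))"
  have Snz: "1 + S \<noteq> 0" using saddle_neq[OF P(1)] by (simp add: S_def)
  have g0: "norm (g 0 S * K) > 0" using K Snz by (simp add: g_def)
  have "c0 > 0"
  proof -
    have "g 1 S = g 0 S * ((1 - S) / (1 + S))" by (simp add: g_def power2_eq_square)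
    hence "cnj (g 0 S * K) * (g 1 S * K) = (g 0 S * K * cnj (g 0 S * K)) * ((1 - S) / (1 + S))"
      by (simp add: mult_ac)
    also have "g 0 S * K * cnj (g 0 S * K) = of_real ((norm (g 0 S * K))\<^sup>2)"
      by (rule complex_norm_square[symmetric])
    finally have "Im (cnj (g 0 S * K) * (g 1 S * K)) = (norm (g 0 S * K))\<^sup>2 * Im ((1 - S) / (1 + S))"
      by (simp only: Im_complex_of_real Re_complex_of_real times_complex.sel)
    also have "Im ((1 - S) / (1 + S)) = - 2 * Im S / (norm (1 + S))\<^sup>2"
      unfolding Im_divide cmod_power2 by (simp add: algebra_simps)
    finally have "Im (cnj (g 0 S * K) * (g 1 S * K)) \<noteq> 0"
      using g0 saddle_Im_pos[OF P(1)] Snz by (simp add: S_def)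
    thus ?thesis unfolding c0_def using g0 by (intro divide_pos_pos) (auto intro: add_pos_nonneg)
  qed
  have "c \<longlonglongrightarrow> c0" unfolding c_def c0_def
    using g0 by (intro tendsto_intros B) (smt (verit) norm_ge_zero)
  hence ev: "eventually (\<lambda>N. c N > c0 / 2) sequentially"
    using \<open>c0 > 0\<close> by (intro order_tendstoD(1)) auto
  have mpos: "eventually (\<lambda>N. m N > 0) sequentially"
    using m by (auto simp: filterlim_at_top Suc_le_eq elim!: allE[of _ 1])
  show ?thesis
  proof (rule that[of "c0 / pi"])
    show "c0 / pi > 0" using \<open>c0 > 0\<close> by simp
    show "eventually (\<lambda>N. rat_error (m N) t (q N) \<ge> c0 / pi * (rate (p N) ^ m N / sqrt (m N))) sequentially"
      using ev mpos q
    proof eventually_elim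
      case (elim N)
      define U where "U = line_phase (p N) (saddle (p N)) ^ m N"
      define \<rho> where "\<rho> = rate (p N) ^ m N"
      have \<rho>: "\<rho> > 0" using rate_pos[OF p(1)] by (simp add: \<rho>_def)
      have U: "norm U = \<rho>"
        unfolding U_def norm_power saddle_modulus[OF p(1)] \<rho>_def ..
      hence U0: "U \<noteq> 0" using \<rho> by auto
      define u where "u = U / of_real \<rho>"
      have u: "norm u = 1" using U \<rho> by (simp add: u_def norm_divide)
      have Re_le: "2 / pi * (\<rho> / sqrt (m N) * \<bar>Re (u * B j N)\<bar>) \<le> rat_error (m N) t (q N)" for j
      proof -
        have "2 / pi * \<bar>Re (LINT y|lborel. indicator {0<..} y *\<^sub>R (line_phase (p N) (Complex (p N) y) ^ m N * g j (Complex (p N) y)))\<bar>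
           \<le> rat_error (m N) t (q N)"
          using rat_error_ge_half_line[OF _ t p(1), of "q N" "m N" N "m N + j"] elim by (simp add: g_def)
        also have "(LINT y|lborel. indicator {0<..} y *\<^sub>R (line_phase (p N) (Complex (p N) y) ^ m N * g j (Complex (p N) y)))
           = (LINT y|lborel. U * (indicator {0<..} y *\<^sub>R ((line_phase (p N) (Complex (p N) y) / line_phase (p N) (saddle (p N))) ^ m N * g j (Complex (p N) y))))"
          using U0 by (intro Bochner_Integration.integral_cong refl) (simp add: U_def power_divide)
        also have "\<dots> = of_real (\<rho> / sqrt (m N)) * (u * B j N)"
          unfolding integral_mult_right_zero B_def u_def using elim \<rho> by simp
        also have "\<bar>Re (of_real (\<rho> / sqrt (m N)) * (u * B j N))\<bar> = \<rho> / sqrt (m N) * \<bar>Re (u * B j N)\<bar>"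
        proof -
          have "Re (of_real (\<rho> / sqrt (m N)) * (u * B j N)) = \<rho> / sqrt (m N) * Re (u * B j N)" by simp
          thus ?thesis using \<rho> by (simp only: abs_mult) simp
        qed
        finally show ?thesis .
      qed
      have "c N \<le> max \<bar>Re (u * B 0 N)\<bar> \<bar>Re (u * B 1 N)\<bar>"
      proof (cases "norm (B 0 N) + norm (B 1 N) = 0")
        case False
        hence "norm (B 0 N) + norm (B 1 N) > 0" by (smt (verit) norm_ge_zero)
        thus ?thesis using abs_Im_cnj_mult_le[OF u, of "B 0 N" "B 1 N"]
          by (simp only: c_def pos_divide_le_eq)
      qed (auto simp: c_def)
      hence "2 / pi * (\<rho> / sqrt (m N) * (c0 / 2)) \<le> 2 / pi * (\<rho> / sqrt (m N) * max \<bar>Re (u * B 0 N)\<bar> \<bar>Re (u * B 1 N)\<bar>)"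
        using elim \<rho> by (intro mult_left_mono) auto
      also have "\<dots> \<le> rat_error (m N) t (q N)"
        using Re_le[of 0] Re_le[of 1] by (auto simp: max_def)
      finally show ?case by (simp add: \<rho>_def mult.commute)
    qed
  qed
qed

section \<open>The limit of the roots\<close>
lemma tendsto_rate: "P \<ge> 3/5 \<Longrightarrow> p \<longlonglongrightarrow> P \<Longrightarrow> (\<lambda>N. rate (p N)) \<longlonglongrightarrow> rate P"
  unfolding rate_def using three_p_sq_gt_1[of P] by (intro tendsto_intros) auto

lemma root_rat_error_limit:
  fixes p q :: "nat \<Rightarrow> real" and m :: "nat \<Rightarrow> nat" and t :: real
  assumes p: "\<And>N. p N \<ge> 3/5" "\<And>N. p N \<le> 4/5" "p \<longlonglongrightarrow> P"
    and m: "filterlim m at_top sequentially" and t: "t > 0"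
    and q: "eventually (\<lambda>N. q N > 0 \<and> t * q N = m N * saddle_alpha (p N)) sequentially"
  shows "(\<lambda>N. root (m N) (rat_error (m N) t (q N))) \<longlonglongrightarrow> rate P"
proof -
  have P: "P \<ge> 3/5" using LIMSEQ_le_const[OF p(3)] p(1) by blast
  have mpos: "eventually (\<lambda>N. m N > 0) sequentially"
    using m by (auto simp: filterlim_at_top Suc_le_eq elim!: allE[of _ 1])
  have m_real: "filterlim (\<lambda>N. real (m N)) at_top sequentially"
    by (rule filterlim_compose[OF filterlim_real_sequentially m])
  have rate: "(\<lambda>N. rate (p N)) \<longlonglongrightarrow> rate P" using P p(3) by (rule tendsto_rate)
  define M where "M = (LINT y|lborel. exp (- y\<^sup>2 / 200 :: real))"
  \<comment> \<open>The summand \<open>1\<close> makes the constant positive, as its \<open>m\<close>-th root as a power requires.\<close>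
  define M' where "M' = 2 * M + 1"
  have "M \<ge> 0" unfolding M_def by (intro integral_nonneg_AE) auto
  hence M': "M' > 0" by (simp add: M'_def)
  obtain \<kappa> where \<kappa>: "\<kappa> > 0"
    "eventually (\<lambda>N. rat_error (m N) t (q N) \<ge> \<kappa> * (rate (p N) ^ m N / sqrt (m N))) sequentially"
    using rat_error_lower[OF p m t q] by blast
  have root_eq: "root n (C * r ^ n) = C powr (1 / n) * r" if "n > 0" "C > 0" "r > 0" for n C r
  proof -
    have "root n (C * r ^ n) = root n C * r"
      using that by (simp add: real_root_mult real_root_power_cancel)
    thus ?thesis using that by (simp add: root_powr_inverse)
  qed
  show ?thesis
  proof (rule tendsto_sandwich)
    show "eventually (\<lambda>N. (\<kappa> / sqrt (m N)) powr (1 / m N) * rate (p N) \<le> root (m N) (rat_error (m N) t (q N))) sequentially"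
      using \<kappa>(2) mpos
    proof eventually_elim
      case (elim N)
      have "root (m N) (\<kappa> / sqrt (m N) * rate (p N) ^ m N) \<le> root (m N) (rat_error (m N) t (q N))"
        using elim by (intro real_root_le_mono) auto
      thus ?case using elim \<kappa>(1) rate_pos[OF p(1)] by (subst (asm) root_eq) auto
    qed
    show "eventually (\<lambda>N. root (m N) (rat_error (m N) t (q N)) \<le> (M' * (2 * m N + 1)) powr (1 / m N) * rate (p N)) sequentially"
      using q mpos
    proof eventually_elim
      case (elim N)
      have "rat_error (m N) t (q N) \<le> 2 * M * real (2 * m N + 1) * rate (p N) ^ m N"
        unfolding M_def using elim by (intro rat_error_upper p t) auto
      also have "\<dots> \<le> M' * (2 * m N + 1) * rate (p N) ^ m N"
        unfolding M'_def using rate_pos[OF p(1), of N] by (intro mult_right_mono) auto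
      finally have "root (m N) (rat_error (m N) t (q N)) \<le> root (m N) (M' * (2 * m N + 1) * rate (p N) ^ m N)"
        using elim by (intro real_root_le_mono) auto
      thus ?case using elim M' rate_pos[OF p(1)] by (subst (asm) root_eq) (auto intro: add_pos_nonneg)
    qed
    have "((\<lambda>x::real. (\<kappa> / sqrt x) powr (1 / x)) \<longlongrightarrow> 1) at_top" using \<kappa>(1) by real_asymp
    from tendsto_mult[OF filterlim_compose[OF this m_real] rate]
    show "(\<lambda>N. (\<kappa> / sqrt (m N)) powr (1 / m N) * rate (p N)) \<longlonglongrightarrow> rate P" by simp
    have "((\<lambda>x::real. (M' * (2 * x + 1)) powr (1 / x)) \<longlongrightarrow> 1) at_top" using M' by real_asymp
    from tendsto_mult[OF filterlim_compose[OF this m_real] rate]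
    show "(\<lambda>N. (M' * (2 * m N + 1)) powr (1 / m N) * rate (p N)) \<longlonglongrightarrow> rate P" by (simp add: add.commute)
  qed
qed

text \<open>
  For each large \<open>N\<close> the exact saddle for the degree \<open>m\<^sub>N\<close> is used; for the finitely many \<open>N\<close> with
  \<open>m\<^sub>N / N\<close> out of range, \<open>p N\<close> is an arbitrary point of the interval.
\<close>
lemma root_rat_error_limit_degree_ratio:
  fixes t :: real and q :: "nat \<Rightarrow> real" and m :: "nat \<Rightarrow> nat"
  assumes t: "t > 0" and q: "\<And>N. N \<ge> 1 \<Longrightarrow> q N = alpha_star * real N / t"
    and P: "P \<ge> 3/5" "P \<le> 4/5" and range: "1/2 < degree_ratio P" "degree_ratio P < 3/2"
    and lim: "(\<lambda>N. real (m N) / real N) \<longlonglongrightarrow> degree_ratio P"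
  shows "(\<lambda>N. root (m N) (rat_error (m N) t (q N))) \<longlonglongrightarrow> rate P"
proof -
  have ev: "eventually (\<lambda>N. 1/2 < m N / N \<and> m N / N < 3/2 \<and> N \<ge> 1) sequentially"
    by (intro eventually_conj eventually_ge_at_top order_tendstoD[OF lim] range)
  have "\<exists>x. x \<ge> 3/5 \<and> x \<le> 4/5 \<and> (1/2 < m N / N \<and> m N / N < 3/2 \<longrightarrow> degree_ratio x = m N / N)" for N
  proof (cases "1/2 < m N / N \<and> m N / N < 3/2")
    case True
    thus ?thesis using degree_ratio_surj[of "m N / N"] by (metis less_imp_le)
  next
    case False
    thus ?thesis using P by auto
  qed
  then obtain p where p: "\<And>N. p N \<ge> 3/5" "\<And>N. p N \<le> 4/5"
    "\<And>N. 1/2 < m N / N \<Longrightarrow> m N / N < 3/2 \<Longrightarrow> degree_ratio (p N) = m N / N"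
    by metis
  have "(\<lambda>N. p N - P) \<longlonglongrightarrow> 0"
  proof (rule Lim_null_comparison)
    have "(\<lambda>N. \<bar>m N / N - degree_ratio P\<bar>) \<longlonglongrightarrow> \<bar>degree_ratio P - degree_ratio P\<bar>"
      by (intro tendsto_intros lim)
    thus "(\<lambda>N. \<bar>m N / N - degree_ratio P\<bar>) \<longlonglongrightarrow> 0" by simp
    show "eventually (\<lambda>N. norm (p N - P) \<le> \<bar>m N / N - degree_ratio P\<bar>) sequentially"
      using ev
    proof eventually_elim
      case (elim N)
      thus ?case using degree_ratio_expanding[OF p(1) P(1), of N] p(3)[of N] by simp
    qed
  qed
  hence pP: "p \<longlonglongrightarrow> P" by (simp add: LIM_zero_iff)
  have "filterlim (\<lambda>N. (real (m N) / real N) * real N) at_top sequentially"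
    using range by (intro filterlim_tendsto_pos_mult_at_top[OF lim] filterlim_real_sequentially) auto
  moreover have "eventually (\<lambda>N. (real (m N) / real N) * real N = real (m N)) sequentially"
    using eventually_ge_at_top[of 1] by eventually_elim simp
  ultimately have "filterlim (\<lambda>N. real (m N)) at_top sequentially"
    using filterlim_cong by fast
  hence m: "filterlim m at_top sequentially" by (simp add: filterlim_sequentially_iff_filterlim_real)
  show ?thesis
  proof (rule root_rat_error_limit[OF p(1,2) pP m t])
    show "eventually (\<lambda>N. q N > 0 \<and> t * q N = m N * saddle_alpha (p N)) sequentially"
      using ev
    proof eventually_elim
      case (elim N)
      have N: "real N > 0" using elim by simp
      have "m N / N > 0" using elim by linarith
      hence mN: "real (m N) > 0" using N by (simp add: zero_less_divide_iff)
      have "saddle_alpha (p N) = alpha_star / (m N / N)"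
        using p(3)[of N] elim alpha_star_degree_ratio[of "p N"] by (simp only:)
      hence "m N * saddle_alpha (p N) = alpha_star * N" using mN by simp
      moreover have "alpha_star > 0" by (simp add: alpha_star_def)
      ultimately show ?case using q[of N] t elim N by simp
    qed
  qed
qed

theorem corollary6p5:
  fixes t :: real and q :: "nat \<Rightarrow> real"
  assumes t: "t > 0"
    and q: "\<And>N. N \<ge> 1 \<Longrightarrow> q N = alpha_star * real N / t"
  shows
    "(\<forall>m :: nat \<Rightarrow> nat. (\<forall>N\<ge>1. m N > 0) \<longrightarrow>
        (\<lambda>N. real (m N) - real N) \<in> o(\<lambda>N. real N) \<longrightarrow>
        (\<lambda>N. root (m N) (rat_error (m N) t (q N))) \<longlonglongrightarrow> sqrt 2 - 1)
     \<and>
     (\<exists>\<delta>>0. \<forall>\<epsilon>::real. \<bar>\<epsilon>\<bar> < \<delta> \<longrightarrow>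
        0 < alpha_star / (1 + \<epsilon>) \<and> alpha_star / (1 + \<epsilon>) < alpha_c \<and>
        (\<forall>m :: nat \<Rightarrow> nat. (\<forall>N\<ge>1. m N > 0) \<longrightarrow>
           (\<lambda>N. real (m N) / real N) \<longlonglongrightarrow> 1 + \<epsilon> \<longrightarrow>
           (\<lambda>N. root (m N) (rat_error (m N) t (q N))) \<longlonglongrightarrow> H_e (alpha_star / (1 + \<epsilon>))))
     \<and>
     (\<lambda>\<epsilon>::real. ln (H_e (alpha_star / (1 + \<epsilon>))) - (ln (sqrt 2 - 1) + \<epsilon>\<^sup>2 / (5 * sqrt 2)))
        \<in> O[at 0](\<lambda>\<epsilon>. \<epsilon> ^ 3)"
proof (intro conjI allI impI)
  fix m :: "nat \<Rightarrow> nat"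
  assume "(\<lambda>N. real (m N) - real N) \<in> o(\<lambda>N. real N)"
  hence "(\<lambda>N. (real (m N) - real N) / real N) \<longlonglongrightarrow> 0" by (rule smalloD_tendsto)
  hence "(\<lambda>N. (real (m N) - real N) / real N + 1) \<longlonglongrightarrow> 0 + 1" by (intro tendsto_intros)
  moreover have "eventually (\<lambda>N. (real (m N) - real N) / real N + 1 = real (m N) / real N) sequentially"
    using eventually_ge_at_top[of 1] by eventually_elim (simp add: field_simps)
  ultimately have lim: "(\<lambda>N. real (m N) / real N) \<longlonglongrightarrow> 1"
    using Lim_transform_eventually by fastforce
  have "(\<lambda>N. root (m N) (rat_error (m N) t (q N))) \<longlonglongrightarrow> rate (1 / sqrt 2)"
    by (rule root_rat_error_limit_degree_ratio[OF t q inv_sqrt2_bounds]) (use lim degree_ratio_center in auto)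
  thus "(\<lambda>N. root (m N) (rat_error (m N) t (q N))) \<longlonglongrightarrow> sqrt 2 - 1"
    by (simp only: rate_center)
next
  show "\<exists>\<delta>>0. \<forall>\<epsilon>::real. \<bar>\<epsilon>\<bar> < \<delta> \<longrightarrow>
        0 < alpha_star / (1 + \<epsilon>) \<and> alpha_star / (1 + \<epsilon>) < alpha_c \<and>
        (\<forall>m :: nat \<Rightarrow> nat. (\<forall>N\<ge>1. m N > 0) \<longrightarrow>
           (\<lambda>N. real (m N) / real N) \<longlonglongrightarrow> 1 + \<epsilon> \<longrightarrow>
           (\<lambda>N. root (m N) (rat_error (m N) t (q N))) \<longlonglongrightarrow> H_e (alpha_star / (1 + \<epsilon>)))"
  proof (intro exI[of _ "1/2 :: real"] conjI allI impI)
    fix \<epsilon> :: real assume \<epsilon>: "\<bar>\<epsilon>\<bar> < 1/2"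
    show pos: "0 < alpha_star / (1 + \<epsilon>)" using \<epsilon> by (simp add: alpha_star_def)
    have "alpha_star \<le> 4/5" using inv_sqrt2_bounds by (simp add: alpha_star_def)
    moreover have e: "1 + \<epsilon> > 1/2" using \<epsilon> by (simp add: abs_less_iff)
    moreover from e have "2 * (1 + \<epsilon>) > 1" by simp
    ultimately have "alpha_star < 2 * (1 + \<epsilon>)" by simp
    hence "alpha_star / (1 + \<epsilon>) < 2" using e by (simp add: pos_divide_less_eq)
    also have "2 < alpha_c"
      unfolding alpha_c_def using real_less_rsqrt[of "4/3" 3] by (simp add: power2_eq_square)
    finally show "alpha_star / (1 + \<epsilon>) < alpha_c" .
    fix m :: "nat \<Rightarrow> nat" assume lim: "(\<lambda>N. real (m N) / real N) \<longlonglongrightarrow> 1 + \<epsilon>"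
    obtain P where P: "P \<ge> 3/5" "P \<le> 4/5" "degree_ratio P = 1 + \<epsilon>"
    proof (rule degree_ratio_surj)
      show "1/2 \<le> 1 + \<epsilon>" "1 + \<epsilon> \<le> 3/2" using \<epsilon> by (auto simp: abs_less_iff)
    qed
    have "(\<lambda>N. root (m N) (rat_error (m N) t (q N))) \<longlonglongrightarrow> rate P"
      by (rule root_rat_error_limit_degree_ratio[OF t q P(1,2)]) (use lim P(3) \<epsilon> in auto)
    thus "(\<lambda>N. root (m N) (rat_error (m N) t (q N))) \<longlonglongrightarrow> H_e (alpha_star / (1 + \<epsilon>))"
      using P alpha_star_degree_ratio[of P] H_e_saddle_alpha[of P] by simp
  qed auto
next
  obtain C where C: "\<And>x. x \<in> {4/5..6/5} \<Longrightarrow>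
      \<bar>ln (rate (x / sqrt 2)) - (ln (sqrt 2 - 1) + (degree_ratio (x / sqrt 2) - 1)\<^sup>2 / (5 * sqrt 2))\<bar> \<le> C * \<bar>x - 1\<bar> ^ 3"
    using ln_rate_expansion by metis
  show "(\<lambda>\<epsilon>::real. ln (H_e (alpha_star / (1 + \<epsilon>))) - (ln (sqrt 2 - 1) + \<epsilon>\<^sup>2 / (5 * sqrt 2)))
        \<in> O[at 0](\<lambda>\<epsilon>. \<epsilon> ^ 3)"
    \<comment> \<open>The factor \<open>8\<close> is \<open>2 ^ 3\<close>: \<open>\<bar>x - 1\<bar> \<le> 2 * \<bar>\<epsilon>\<bar>\<close> because \<open>degree_ratio\<close> is expanding.\<close>
  proof (rule bigoI[of _ "8 * \<bar>C\<bar>"])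
    have "eventually (\<lambda>\<epsilon>::real. \<epsilon> \<in> {-1/10<..<1/10}) (at 0)"
      by (intro eventually_at_in_open') auto
    thus "eventually (\<lambda>\<epsilon>::real. norm (ln (H_e (alpha_star / (1 + \<epsilon>))) - (ln (sqrt 2 - 1) + \<epsilon>\<^sup>2 / (5 * sqrt 2)))
        \<le> 8 * \<bar>C\<bar> * norm (\<epsilon> ^ 3)) (at 0)"
    proof eventually_elim
      case (elim \<epsilon>)
      obtain P where P: "P \<ge> 3/5" "P \<le> 4/5" "degree_ratio P = 1 + \<epsilon>"
      proof (rule degree_ratio_surj)
        show "1/2 \<le> 1 + \<epsilon>" "1 + \<epsilon> \<le> 3/2" using elim by auto
      qed
      define x where "x = sqrt 2 * P"
      have Px: "P = x / sqrt 2" by (simp add: x_def)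
      have "\<bar>P - 1 / sqrt 2\<bar> \<le> \<bar>\<epsilon>\<bar>"
        using degree_ratio_expanding[OF P(1) inv_sqrt2_bounds(1)] by (simp add: P(3) degree_ratio_center)
      moreover have "\<bar>x - 1\<bar> = sqrt 2 * \<bar>P - 1 / sqrt 2\<bar>"
      proof -
        have "x - 1 = sqrt 2 * (P - 1 / sqrt 2)" by (simp add: x_def algebra_simps)
        thus ?thesis by (simp add: abs_mult)
      qed
      ultimately have "\<bar>x - 1\<bar> \<le> 2 * \<bar>\<epsilon>\<bar>"
        using mult_mono[of "sqrt 2" 2 "\<bar>P - 1 / sqrt 2\<bar>" "\<bar>\<epsilon>\<bar>"] real_le_lsqrt[of 2 2] by simp
      moreover from this have "x \<in> {4/5..6/5}" using elim by (auto simp: abs_le_iff)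
      ultimately have "C * \<bar>x - 1\<bar> ^ 3 \<le> \<bar>C\<bar> * (2 * \<bar>\<epsilon>\<bar>) ^ 3"
        by (intro mult_mono power_mono) auto
      moreover have "H_e (alpha_star / (1 + \<epsilon>)) = rate (x / sqrt 2)"
        using alpha_star_degree_ratio[of P] H_e_saddle_alpha[OF P(1)] by (simp add: P(3) Px[symmetric])
      ultimately show ?case
        using C[OF \<open>x \<in> _\<close>] P(3) by (simp add: Px[symmetric] power_mult_distrib power_abs)
    qed
  qed
qed

end
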